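(* Let $0<\beta\le\alpha\le1$, $0<\theta\le1$, $[0,T]\subset[0,1]$, and let $F=(F_{ij}):\mathbb{R}_+\times\mathbb{R}^m\times\mathbb{R}^d\to\mathcal{L}(\mathbb{R}^d,\mathbb{R}^m)$ have continuous components $F_{ij}$ that are $\theta$-Hölder in $t$, $y$ and $x_k$ ($k\ne j$), locally uniformly in $x_j$, and $\theta$-Hölder continuously differentiable in $y$, i.e. $D_yF_{ij}=(\partial F_{ij}/\partial y_k)_{k=1}^m$ exists, is continuous, and is $\theta$-Hölder in $t$, $y$ and $x_k$ ($k\neq j$), locally uniformly in $x_j$. If $\gamma>0$ and $0<\beta-\gamma<\beta_0<\theta\beta$, then for every $x\in G_{\beta_0,\gamma}([0,T])\cap H_\alpha([0,T],\mathbb{R}^d)$ and every $y_0\in\mathbb{R}^m$ there exists a unique solution $y\in H_\beta([0,T],\mathbb{R}^m)$ of $$dy(t)=F(t,y(t),x(t))\,dx(t),\quad y(0)=y_0,\quad t\in[0,T].$$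
   Context: $H_\alpha([0,T],\mathbb{R}^d)$ is the class of $\alpha$-Hölder maps $[0,T]\to\mathbb{R}^d$. A function $\Phi(t,y,x)$ is "$\theta$-Hölder in $t,y,x_k$ ($k\neq j$), locally uniformly in $x_j$" if for every compact $K\subset\mathbb{R}$ there is $L<\infty$ with $|\Phi(t,y,x)-\Phi(t',y',x')|\le L(|t-t'|^\theta+|y-y'|^\theta+|x-x'|^\theta)$ for all $t,t'\in[0,1]$, $y,y'\in\mathbb{R}^m$, $x,x'\in\mathbb{R}^d$ with $x_j=x'_j\in K$. Integral: put $t_{k,n}=n2^{-k}$ and, for a continuous real function $g$ on $[0,T]$, $h_{k,n}=h_{k,n}(g)=2^k\int_{t_{k,n}}^{t_{k,n+1}}g(\tau)\,d\tau$ when $[t_{k,n},t_{k,n+1}]\subset[0,T]$. For $0\le a<b\le T$, $k\ge1$, let $n_k(a)$, $n_k(b)$ be the smallest and largest element of $\{n:0\le n\le2^k,\ [t_{k-1,\lfloor n/2\rfloor},t_{k-1,\lfloor n/2\rfloor+1}]\subset[a,b]\}$ (empty sums are $0$). For continuous $f$, $$\int_a^bf(t,g(t))\,dg(t)=\lim_{k\to\infty}\sum_{n=n_k(a)+1}^{n_k(b)}\int_{h_{k,n-1}}^{h_{k,n}}f(t_{k,n},\xi)\,d\xi,$$ if the limit exists (finite). For vector paths, $\int_a^bF(u,y(u),x(u))\,dx(u)$ is the $m$-vector with $i$-th entry $\sum_{j=1}^d\int_a^bF_{ij}(u,y(u),x(u))\,dx_j(u)$, where the $j$-th term is the integral $\int_a^bf(t,g(t))\,dg(t)=\lim_{k\to\infty}\sum_{n=n_k(a)+1}^{n_k(b)}\int_{h_{k,n-1}(g)}^{h_{k,n}(g)}f(t_{k,n},\xi)\,d\xi$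 with $g=x_j$ and $f(t,\xi)=F_{ij}(t,y(t),x_1(t),\dots,x_{j-1}(t),\xi,x_{j+1}(t),\dots,x_d(t))$. A solution of the equation is a function $y\in H_\beta([0,T],\mathbb{R}^m)$ with $y(t)=y_0+\int_0^tF(u,y(u),x(u))\,dx(u)$ for $t\in[0,T]$ (the integrals existing). Class $G_{\beta,\gamma}([0,T])$ ($\beta,\gamma>0$): the set of $x\in C([0,T],\mathbb{R}^d)$ with $$|x,G_{\beta,\gamma}([0,T])|=\sup_{0\le a<b\le T,\ 1\le j\le d}\frac{\mu(x_j,a,b,\beta)}{(b-a)^{\beta+\gamma}}<\infty,$$ $$\mu(g,a,b,\beta)=\sum_{k=k_0+1}^\infty2^{-(k+1)\beta}\sum_{n:\,[t_{k,n-1},t_{k,n}]\subset[a,b]}|h_{k+1,2(n-1)}(g)-h_{k+1,2(n-1)+1}(g)|,$$ where $k_0=\lfloor\log_2(2/(b-a))\rfloor$ (so that $2^{-k_0-1}\le b-a\le2^{-k_0+1}$). *)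

theory Defs
  imports "HOL-Analysis.Analysis"
begin

text \<open>
  Paths on \<open>[0,T]\<close> are total functions on the reals of which only the values on \<open>{0..T}\<close> are used.
  A map into the linear operators from \<open>R^d\<close> to \<open>R^m\<close> is a matrix-valued function, so that
  its component \<open>F_ij\<close> at \<open>(t, y, x)\<close> is \<open>F t y x $ i $ j\<close>.
\<close>

definition holder_class :: "real \<Rightarrow> real \<Rightarrow> (real \<Rightarrow> 'a::real_normed_vector) set" where
  "holder_class \<alpha> T =
     {x. \<exists>C. \<forall>s\<in>{0..T}. \<forall>t\<in>{0..T}. norm (x s - x t) \<le> C * \<bar>s - t\<bar> powr \<alpha>}"

definition dyadic :: "nat \<Rightarrow> nat \<Rightarrow> real" where
  "dyadic k n = real n / 2 ^ k"

definition dyadic_mean :: "(real \<Rightarrow> real) \<Rightarrow> nat \<Rightarrow> nat \<Rightarrow> real" where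
  "dyadic_mean g k n = 2 ^ k * integral {dyadic k n..dyadic k (n + 1)} g"

text \<open>The index sets are only meaningful for \<open>k \<ge> 1\<close>; the term \<open>k = 0\<close> does not affect the limit below.\<close>

definition dyadic_indices :: "real \<Rightarrow> real \<Rightarrow> nat \<Rightarrow> nat set" where
  "dyadic_indices a b k =
     {n. n \<le> 2 ^ k \<and> {dyadic (k - 1) (n div 2)..dyadic (k - 1) (n div 2 + 1)} \<subseteq> {a..b}}"

definition dyadic_sum ::
    "(real \<Rightarrow> real \<Rightarrow> real) \<Rightarrow> (real \<Rightarrow> real) \<Rightarrow> real \<Rightarrow> real \<Rightarrow> nat \<Rightarrow> real" where
  "dyadic_sum f g a b k =
     (if dyadic_indices a b k = {} then 0
      else \<Sum>n = Min (dyadic_indices a b k) + 1..Max (dyadic_indices a b k).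
             LBINT \<xi>=dyadic_mean g k (n - 1)..dyadic_mean g k n. f (dyadic k n) \<xi>)"

text \<open>For \<open>a = b\<close> all index sets are empty, so the integral exists and is 0.\<close>

definition dyadic_integrable ::
    "(real \<Rightarrow> real \<Rightarrow> real) \<Rightarrow> (real \<Rightarrow> real) \<Rightarrow> real \<Rightarrow> real \<Rightarrow> bool" where
  "dyadic_integrable f g a b \<longleftrightarrow> convergent (dyadic_sum f g a b)"

definition dyadic_integral ::
    "(real \<Rightarrow> real \<Rightarrow> real) \<Rightarrow> (real \<Rightarrow> real) \<Rightarrow> real \<Rightarrow> real \<Rightarrow> real" where
  "dyadic_integral f g a b = lim (dyadic_sum f g a b)"

definition integrand ::
    "(real \<Rightarrow> real^'m \<Rightarrow> real^'d \<Rightarrow> real^'d^'m) \<Rightarrow> (real \<Rightarrow> real^'m) \<Rightarrow> (real \<Rightarrow> real^'d)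
      \<Rightarrow> 'm \<Rightarrow> 'd \<Rightarrow> real \<Rightarrow> real \<Rightarrow> real" where
  "integrand F y x i j t \<xi> = F t (y t) (\<chi> l. if l = j then \<xi> else x t $ l) $ i $ j"

definition path_integrable ::
    "(real \<Rightarrow> real^'m \<Rightarrow> real^'d \<Rightarrow> real^'d^'m) \<Rightarrow> (real \<Rightarrow> real^'m) \<Rightarrow> (real \<Rightarrow> real^'d)
      \<Rightarrow> real \<Rightarrow> real \<Rightarrow> bool" where
  "path_integrable F y x a b \<longleftrightarrow>
     (\<forall>i j. dyadic_integrable (integrand F y x i j) (\<lambda>t. x t $ j) a b)"

definition path_integral ::
    "(real \<Rightarrow> real^'m \<Rightarrow> real^'d \<Rightarrow> real^'d^'m) \<Rightarrow> (real \<Rightarrow> real^'m) \<Rightarrow> (real \<Rightarrow> real^'d)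
      \<Rightarrow> real \<Rightarrow> real \<Rightarrow> real^'m" where
  "path_integral F y x a b =
     (\<chi> i. \<Sum>j\<in>UNIV. dyadic_integral (integrand F y x i j) (\<lambda>t. x t $ j) a b)"

definition is_solution ::
    "real \<Rightarrow> real \<Rightarrow> (real \<Rightarrow> real^'m \<Rightarrow> real^'d \<Rightarrow> real^'d^'m) \<Rightarrow> (real \<Rightarrow> real^'d) \<Rightarrow> real^'m
      \<Rightarrow> (real \<Rightarrow> real^'m) \<Rightarrow> bool" where
  "is_solution \<beta> T F x y0 y \<longleftrightarrow>
     y \<in> holder_class \<beta> T \<and>
     (\<forall>t\<in>{0..T}. path_integrable F y x 0 t \<and> y t = y0 + path_integral F y x 0 t)"

text \<open>
  The quantity \<open>\<mu>(g,a,b,\<beta>)\<close> is an extended nonnegative real, since its series may diverge.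
  It is used for \<open>b - a \<le> 1\<close> only, where \<open>k\<^sub>0 \<ge> 1\<close>, so the conversion to \<open>nat\<close> is harmless.
\<close>

definition mu :: "(real \<Rightarrow> real) \<Rightarrow> real \<Rightarrow> real \<Rightarrow> real \<Rightarrow> ennreal" where
  "mu g a b \<beta> =
     (let k0 = nat \<lfloor>log 2 (2 / (b - a))\<rfloor> in
      \<Sum>i. let k = k0 + 1 + i in
        ennreal (2 powr (- (real (k + 1) * \<beta>)) *
          (\<Sum>n\<in>{n. 1 \<le> n \<and> {dyadic k (n - 1)..dyadic k n} \<subseteq> {a..b}}.
             \<bar>dyadic_mean g (k + 1) (2 * (n - 1)) - dyadic_mean g (k + 1) (2 * (n - 1) + 1)\<bar>)))"

definition G_norm :: "real \<Rightarrow> real \<Rightarrow> real \<Rightarrow> (real \<Rightarrow> real^'d) \<Rightarrow> ennreal" where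
  "G_norm \<beta> \<gamma> T x =
     (SUP (a, b, j) \<in> {(a, b, j). 0 \<le> a \<and> a < b \<and> b \<le> T}.
        mu (\<lambda>t. x t $ j) a b \<beta> / ennreal ((b - a) powr (\<beta> + \<gamma>)))"

definition G_class :: "real \<Rightarrow> real \<Rightarrow> real \<Rightarrow> (real \<Rightarrow> real^'d) set" where
  "G_class \<beta> \<gamma> T = {x. continuous_on {0..T} x \<and> G_norm \<beta> \<gamma> T x < \<infinity>}"

definition holder_except ::
    "real \<Rightarrow> 'd \<Rightarrow> (real \<Rightarrow> real^'m \<Rightarrow> real^'d \<Rightarrow> 'b::real_normed_vector) \<Rightarrow> bool" where
  "holder_except \<theta> j \<Phi> \<longleftrightarrow>
     (\<forall>K. compact K \<longrightarrow>
       (\<exists>L. \<forall>t\<in>{0..1}. \<forall>t'\<in>{0..1}. \<forall>y y' x x'. x $ j = x' $ j \<and> x $ j \<in> K \<longrightarrow>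
          norm (\<Phi> t y x - \<Phi> t' y' x')
            \<le> L * (\<bar>t - t'\<bar> powr \<theta> + norm (y - y') powr \<theta> + norm (x - x') powr \<theta>)))"

definition continuous_coeff ::
    "(real \<Rightarrow> real^'m \<Rightarrow> real^'d \<Rightarrow> 'b::topological_space) \<Rightarrow> bool" where
  "continuous_coeff \<Phi> \<longleftrightarrow> continuous_on ({0..} \<times> UNIV \<times> UNIV) (\<lambda>(t, y, x). \<Phi> t y x)"

definition has_y_gradient ::
    "(real \<Rightarrow> real^'m \<Rightarrow> real^'d \<Rightarrow> real) \<Rightarrow> (real \<Rightarrow> real^'m \<Rightarrow> real^'d \<Rightarrow> real^'m) \<Rightarrow> bool" where
  "has_y_gradient \<Phi> D \<longleftrightarrow>
     (\<forall>t\<ge>0. \<forall>y x k. ((\<lambda>s. \<Phi> t (y + s *\<^sub>R axis k 1) x) has_real_derivative D t y x $ k) (at 0))"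

end

theory Submission
  imports Defs
begin

text \<open>
  Refining the dyadic grid replaces the mean of \<open>g\<close> over a cell by the means over its two halves,
  which lie symmetrically about it. The polygon through the means of level \<open>k + 1\<close> therefore visits the
  means of level \<open>k\<close> on its way, and two consecutive dyadic sums differ, apart from a few jumps at the
  ends of the interval, only by integrals of \<open>f(t, \<cdot>) - f(t', \<cdot>)\<close> with \<open>\<bar>t - t'\<bar> = 2^-(k+1)\<close> over the
  segments that join the means of the two halves of a cell. If \<open>f\<close> is Hoelder in time with exponent
  \<open>\<kappa>\<close> (the \<open>\<beta>\<^sub>0\<close> of the theorem) and constant \<open>B\<close>, and is bounded by \<open>A\<close>, then the sum of these
  differences is at most \<open>B\<close> times the quantity \<open>\<mu>\<close> that defines the class of driving paths, and the
  end jumps form a geometric series. Hence the integral exists and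
  \<open>\<bar>\<integral>\<^sub>s\<^sup>t f dg\<bar> \<le> c (A (t - s)^\<alpha> + B (t - s)^(\<kappa> + \<gamma>))\<close> (\<open>dyadic_integral_exists_le\<close>).
  It is additive in the interval because the sums over \<open>[a, c]\<close> and
  \<open>[c, b]\<close> omit at most three jumps near \<open>c\<close> (\<open>dyadic_integral_add\<close>).

  For \<open>f(t, \<xi>) = F(t, y(t), x(t) with its j-th entry replaced by \<xi>)\<close>, a path \<open>y\<close> with \<open>\<beta>\<close>-Hoelder constant
  \<open>M\<close> gives \<open>B = O(1 + M)\<close>, because \<open>\<kappa> < \<theta> \<beta>\<close>. Since \<open>\<kappa> + \<gamma> > \<beta>\<close>, the second term of the estimate
  carries a positive power of the length of the interval when the result is measured with exponent
  \<open>\<beta>\<close>. The first term carries none if \<open>\<alpha> = \<beta>\<close>; but it does not involve \<open>M\<close> except through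
  \<open>\<bar>y(t) - y(a)\<bar> \<le> M (t - a)^\<beta>\<close>. For the difference of two paths that start at the same point the first
  term is small for the same reason, and a four-point estimate based on one mean value theorem for both
  times (\<open>increment_difference\<close>) bounds the Hoelder constant of the difference of the integrands by
  that of the difference of the paths. So on short intervals the integral operator maps a Hoelder
  ball into itself and contracts.

  These facts are the hypotheses of the locale \<open>holder_volterra\<close>, in which the equation is solved. As
  \<open>\<theta> \<le> 1\<close>, the coefficient grows at most linearly, so the length of the interval on which a solution
  can be bounded by its initial value does not depend on that value; iteration bounds all solutions on
  \<open>[0, T]\<close> (\<open>a_priori_bound\<close>). The step on which the operator contracts depends on the size of the
  solution, hence it can be chosen once and for all, and finitely many local solutions are glued.
\<close>

section \<open>Integrals of a continuous function between two points\<close>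

text \<open>
  Working with a primitive makes additivity in the end points immediate for every order of the points,
  which matters because consecutive means of a path are not ordered.
\<close>

lemma LBINT_primitive:
  fixes \<phi> :: "real \<Rightarrow> real"
  assumes "continuous_on UNIV \<phi>"
  shows "\<exists>P. (\<forall>u v. (LBINT \<xi>=ereal u..ereal v. \<phi> \<xi>) = P v - P u)
    \<and> (\<forall>u. (P has_real_derivative \<phi> u) (at u))"
proof -
  define P where "P u = (LBINT \<xi>=ereal 0..ereal u. \<phi> \<xi>)" for u
  have D: "(P has_vector_derivative \<phi> u) (at u)" for u
  proof -
    have "(P has_vector_derivative \<phi> u) (at u within {- \<bar>u\<bar> - 1..\<bar>u\<bar> + 1})"
      unfolding P_def
      by (rule interval_integral_FTC2) (simp, simp, rule continuous_on_subset[OF assms], simp, linarith, linarith)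
    moreover have "at u within {- \<bar>u\<bar> - 1..\<bar>u\<bar> + 1} = at u"
      by (rule at_within_interior) (simp add: abs_real_def)
    ultimately show ?thesis by simp
  qed
  have "(LBINT \<xi>=ereal u..ereal v. \<phi> \<xi>) = P v - P u" for u v :: real
    by (rule interval_integral_FTC_finite)
      (rule continuous_on_subset[OF assms], simp, rule has_vector_derivative_at_within, rule D)
  then show ?thesis using D unfolding has_real_derivative_iff_has_vector_derivative by blast
qed

lemma LBINT_trans:
  fixes \<phi> :: "real \<Rightarrow> real"
  assumes "continuous_on UNIV \<phi>"
  shows "(LBINT \<xi>=ereal u..ereal v. \<phi> \<xi>) + (LBINT \<xi>=ereal v..ereal w. \<phi> \<xi>)
    = (LBINT \<xi>=ereal u..ereal w. \<phi> \<xi>)"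
proof -
  obtain P where "\<And>u v. (LBINT \<xi>=ereal u..ereal v. \<phi> \<xi>) = P v - P u"
    using LBINT_primitive[OF assms] by auto
  then show ?thesis by simp
qed

lemma LBINT_diff:
  fixes \<phi> \<psi> :: "real \<Rightarrow> real"
  assumes "continuous_on UNIV \<phi>" "continuous_on UNIV \<psi>"
  shows "(LBINT \<xi>=ereal u..ereal v. \<phi> \<xi> - \<psi> \<xi>)
    = (LBINT \<xi>=ereal u..ereal v. \<phi> \<xi>) - (LBINT \<xi>=ereal u..ereal v. \<psi> \<xi>)"
  using assms
  by (intro interval_lebesgue_integral_diff interval_integrable_isCont)
     (auto simp: continuous_on_eq_continuous_at)

lemma LBINT_abs_le:
  fixes \<phi> :: "real \<Rightarrow> real"
  assumes c: "continuous_on UNIV \<phi>" and b: "\<And>\<xi>. \<xi> \<in> {-R..R} \<Longrightarrow> \<bar>\<phi> \<xi>\<bar> \<le> A"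
    and uv: "u \<in> {-R..R}" "v \<in> {-R..R}"
  shows "\<bar>LBINT \<xi>=ereal u..ereal v. \<phi> \<xi>\<bar> \<le> A * \<bar>v - u\<bar>"
proof -
  obtain P where P: "\<And>u v. (LBINT \<xi>=ereal u..ereal v. \<phi> \<xi>) = P v - P u"
    and D: "\<And>u. (P has_real_derivative \<phi> u) (at u)"
    using LBINT_primitive[OF c] by auto
  have "norm (P v - P u) \<le> A * norm (v - u)"
    by (rule field_differentiable_bound[of "{-R..R}" P \<phi>])
       (use D b uv in \<open>auto intro: has_field_derivative_at_within\<close>)
  then show ?thesis by (simp add: P)
qed

section \<open>Dyadic grids, index ranges and cell means\<close>

text \<open>
  The cells of level \<open>m\<close> that lie in \<open>[a, b]\<close> are those with number at least \<open>ceil_index a m\<close> and less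
  than \<open>floor_index b m\<close>.
\<close>

definition ceil_index :: "real \<Rightarrow> nat \<Rightarrow> nat" where "ceil_index a m = nat \<lceil>a * 2 ^ m\<rceil>"
definition floor_index :: "real \<Rightarrow> nat \<Rightarrow> nat" where "floor_index b m = nat \<lfloor>b * 2 ^ m\<rfloor>"

lemma ceil_index_le_iff: "ceil_index a m \<le> n \<longleftrightarrow> a \<le> dyadic m n"
  unfolding ceil_index_def dyadic_def by (simp add: field_simps nat_le_iff ceiling_le_iff)

lemma le_floor_index_iff: "0 \<le> b \<Longrightarrow> n \<le> floor_index b m \<longleftrightarrow> dyadic m n \<le> b"
  unfolding floor_index_def dyadic_def by (simp add: field_simps le_nat_iff le_floor_iff)

lemma dyadic_Suc_double: "dyadic (Suc k) (2 * n) = dyadic k n"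
  by (simp add: dyadic_def)

lemma dyadic_mono: "m \<le> n \<Longrightarrow> dyadic k m \<le> dyadic k n"
  by (simp add: dyadic_def divide_right_mono)

lemma dyadic_less_iff: "dyadic k m < dyadic k n \<longleftrightarrow> m < n"
  by (simp add: dyadic_def divide_less_cancel)

lemma dyadic_nonneg: "0 \<le> dyadic k n" by (simp add: dyadic_def)

lemma dyadic_step: "dyadic k (Suc n) = dyadic k n + 1 / 2 ^ k"
  by (simp add: dyadic_def add_divide_distrib)

lemma ceil_index_refine: "ceil_index a (Suc m) \<le> 2 * ceil_index a m" "2 * ceil_index a m \<le> ceil_index a (Suc m) + 1"
proof -
  show "ceil_index a (Suc m) \<le> 2 * ceil_index a m"
    using ceil_index_le_iff[of a m "ceil_index a m"] ceil_index_le_iff[of a "Suc m" "2 * ceil_index a m"]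
    by (simp add: dyadic_Suc_double)
  define n where "n = (ceil_index a (Suc m) + 1) div 2"
  have "a \<le> dyadic (Suc m) (ceil_index a (Suc m))" using ceil_index_le_iff by blast
  also have "\<dots> \<le> dyadic (Suc m) (2 * n)" unfolding n_def by (rule dyadic_mono) presburger
  finally have "ceil_index a m \<le> n" by (simp add: ceil_index_le_iff dyadic_Suc_double)
  then show "2 * ceil_index a m \<le> ceil_index a (Suc m) + 1" unfolding n_def by presburger
qed

lemma floor_index_refine: assumes "0 \<le> b" shows "2 * floor_index b m \<le> floor_index b (Suc m)" "floor_index b (Suc m) \<le> 2 * floor_index b m + 1"
proof -
  show "2 * floor_index b m \<le> floor_index b (Suc m)"
    using le_floor_index_iff[OF assms, of "floor_index b m" m] le_floor_index_iff[OF assms, of "2 * floor_index b m" "Suc m"]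
    by (simp add: dyadic_Suc_double)
  define n where "n = floor_index b (Suc m) div 2"
  have "dyadic (Suc m) (2 * n) \<le> dyadic (Suc m) (floor_index b (Suc m))"
    unfolding n_def by (rule dyadic_mono) presburger
  also have "\<dots> \<le> b" using le_floor_index_iff[OF assms] by blast
  finally have "n \<le> floor_index b m" by (simp add: le_floor_index_iff[OF assms] dyadic_Suc_double)
  then show "floor_index b (Suc m) \<le> 2 * floor_index b m + 1" unfolding n_def by presburger
qed

text \<open>
  In \<open>dyadic_sum\<close> an index \<open>n\<close> of level \<open>Suc m\<close> is admitted if the cell \<open>n div 2\<close> of level \<open>m\<close> lies in
  the interval. The admitted indices therefore form a range with even end points, and the sum can be
  written over a half-open range, which is empty precisely when no cell fits.
\<close>

definition jump :: "(real \<Rightarrow> real \<Rightarrow> real) \<Rightarrow> (real \<Rightarrow> real) \<Rightarrow> nat \<Rightarrow> nat \<Rightarrow> real" where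
  "jump f g k n = (LBINT \<xi>=dyadic_mean g k (n - 1)..dyadic_mean g k n. f (dyadic k n) \<xi>)"

lemma dyadic_indices_eq:
  assumes "0 \<le> b" "b \<le> 1"
  shows "dyadic_indices a b (Suc m) = {2 * ceil_index a m..<2 * floor_index b m}"
proof -
  have "n \<in> dyadic_indices a b (Suc m) \<longleftrightarrow> n \<in> {2 * ceil_index a m..<2 * floor_index b m}" for n
  proof -
    have "n \<in> dyadic_indices a b (Suc m) \<longleftrightarrow>
      n \<le> 2 ^ Suc m \<and> a \<le> dyadic m (n div 2) \<and> dyadic m (n div 2 + 1) \<le> b"
      using dyadic_less_iff[of m "n div 2" "n div 2 + 1"]
      by (auto simp: dyadic_indices_def)
    also have "\<dots> \<longleftrightarrow> n \<le> 2 ^ Suc m \<and> ceil_index a m \<le> n div 2 \<and> n div 2 + 1 \<le> floor_index b m"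
      using ceil_index_le_iff[of a m "n div 2"] le_floor_index_iff[OF assms(1), of "n div 2 + 1" m] by simp
    also have "\<dots> \<longleftrightarrow> n \<le> 2 ^ Suc m \<and> n \<in> {2 * ceil_index a m..<2 * floor_index b m}"
    proof -
      have "ceil_index a m \<le> n div 2 \<longleftrightarrow> 2 * ceil_index a m \<le> n" by linarith
      moreover have "n div 2 + 1 \<le> floor_index b m \<longleftrightarrow> n < 2 * floor_index b m" by linarith
      ultimately show ?thesis by simp
    qed
    also have "\<dots> \<longleftrightarrow> n \<in> {2 * ceil_index a m..<2 * floor_index b m}"
    proof -
      have "dyadic m (floor_index b m) \<le> 1" using le_floor_index_iff[OF assms(1), of "floor_index b m" m] assms by simp
      then have "real (floor_index b m) \<le> real (2 ^ m)" by (simp add: dyadic_def)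
      then have "floor_index b m \<le> 2 ^ m" by (simp only: of_nat_le_iff)
      then show ?thesis by auto
    qed
    finally show ?thesis .
  qed
  then show ?thesis by blast
qed

lemma dyadic_sum_eq:
  assumes "0 \<le> b" "b \<le> 1"
  shows "dyadic_sum f g a b (Suc m) = (\<Sum>n = 2 * ceil_index a m + 1..<2 * floor_index b m. jump f g (Suc m) n)"
proof (cases "ceil_index a m < floor_index b m")
  case True
  then have ne: "{2 * ceil_index a m..<2 * floor_index b m} \<noteq> {}" by auto
  have mn: "Min {2 * ceil_index a m..<2 * floor_index b m} = 2 * ceil_index a m" using True by (intro Min_eqI) auto
  have mx: "Max {2 * ceil_index a m..<2 * floor_index b m} = 2 * floor_index b m - 1" using True by (intro Max_eqI) auto
  have "{2 * ceil_index a m + 1..2 * floor_index b m - 1} = {2 * ceil_index a m + 1..<2 * floor_index b m}" using True by auto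
  then show ?thesis
    using ne by (simp add: dyadic_sum_def dyadic_indices_eq[OF assms] mn mx jump_def)
next
  case False
  then have "{2 * ceil_index a m..<2 * floor_index b m} = {}" "{2 * ceil_index a m + 1..<2 * floor_index b m} = {}" by auto
  then show ?thesis by (simp add: dyadic_sum_def dyadic_indices_eq[OF assms])
qed

lemma dyadic_mean_near:
  assumes "continuous_on {dyadic k n..dyadic k (n+1)} g"
    and "\<And>s. s \<in> {dyadic k n..dyadic k (n+1)} \<Longrightarrow> \<bar>g s - c\<bar> \<le> e"
  shows "\<bar>dyadic_mean g k n - c\<bar> \<le> e"
proof -
  have int: "g integrable_on {dyadic k n..dyadic k (n+1)}" using assms(1) by (rule integrable_continuous_real)
  have len: "dyadic k (n+1) - dyadic k n = 1 / 2 ^ k" using dyadic_step[of k n] by simp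
  have "integral {dyadic k n..dyadic k (n+1)} (\<lambda>s. g s - c)
     = integral {dyadic k n..dyadic k (n+1)} g - c / 2 ^ k"
    using int len by (subst Henstock_Kurzweil_Integration.integral_diff) (auto simp: dyadic_mono)
  moreover have "norm (integral {dyadic k n..dyadic k (n+1)} (\<lambda>s. g s - c))
      \<le> e * (dyadic k (n+1) - dyadic k n)"
  proof (rule integral_bound)
    show "continuous_on {dyadic k n..dyadic k (n+1)} (\<lambda>s. g s - c)"
      using assms(1) by (intro continuous_on_diff continuous_on_const)
  qed (use assms(2) in \<open>simp_all add: dyadic_mono\<close>)
  ultimately have "\<bar>integral {dyadic k n..dyadic k (n+1)} g - c / 2 ^ k\<bar> \<le> e / 2 ^ k"
    unfolding len by simp
  then have "2 ^ k * \<bar>integral {dyadic k n..dyadic k (n+1)} g - c / 2 ^ k\<bar> \<le> 2 ^ k * (e / 2 ^ k)"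
    by (rule mult_left_mono) simp
  also have "2 ^ k * \<bar>integral {dyadic k n..dyadic k (n+1)} g - c / 2 ^ k\<bar>
      = \<bar>2 ^ k * (integral {dyadic k n..dyadic k (n+1)} g - c / 2 ^ k)\<bar>" by (simp add: abs_mult)
  finally show ?thesis by (simp add: dyadic_mean_def algebra_simps)
qed

lemma dyadic_mean_halve:
  assumes "continuous_on {dyadic k n..dyadic k (n+1)} g"
  shows "dyadic_mean g k n = (dyadic_mean g (Suc k) (2 * n) + dyadic_mean g (Suc k) (2 * n + 1)) / 2"
proof -
  have e: "dyadic (Suc k) (2 * n) = dyadic k n" "dyadic (Suc k) (2 * n + 1 + 1) = dyadic k (n + 1)"
    using dyadic_Suc_double[of k n] dyadic_Suc_double[of k "n+1"] by simp_all
  have "integral {dyadic k n..dyadic (Suc k) (2 * n + 1)} g + integral {dyadic (Suc k) (2 * n + 1)..dyadic k (n+1)} g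
     = integral {dyadic k n..dyadic k (n+1)} g"
  proof (rule Henstock_Kurzweil_Integration.integral_combine)
    show "dyadic k n \<le> dyadic (Suc k) (2 * n + 1)" "dyadic (Suc k) (2 * n + 1) \<le> dyadic k (n + 1)"
      unfolding e[symmetric] by (rule dyadic_mono; simp)+
    show "g integrable_on {dyadic k n..dyadic k (n+1)}" using assms by (rule integrable_continuous_real)
  qed
  then show ?thesis unfolding dyadic_mean_def e
    by (metis distrib_left mult.assoc nonzero_mult_div_cancel_left power_Suc times_divide_eq_right zero_neq_numeral)
qed

section \<open>One refinement step of the dyadic sums\<close>

text \<open>
  Each jump of level \<open>k\<close> goes from the mean over one cell to the mean over the next one. It is split at the
  means of level \<open>Suc k\<close> over the right half of the first cell and over the left half of the second cell.
  The middle piece is a jump of level \<open>Suc k\<close> at the same time, so it cancels. What remains is, for each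
  cell, the jump between the means of its halves compared with the two adjoining pieces \<open>rt\<close> and \<open>lt\<close>;
  the first and the last cell lack one of them.
\<close>

lemma jump_refinement:
  fixes f :: "real \<Rightarrow> real \<Rightarrow> real" and g :: "real \<Rightarrow> real" and k :: nat
  defines "h \<equiv> dyadic_mean g k" and "h' \<equiv> dyadic_mean g (Suc k)"
  defines "rt \<equiv> \<lambda>m. LBINT \<xi>=h' (2 * m)..h m. f (dyadic k m) \<xi>"
    and "lt \<equiv> \<lambda>m. LBINT \<xi>=h m..h' (2 * m + 1). f (dyadic k (Suc m)) \<xi>"
  assumes cont: "\<And>t. 0 \<le> t \<Longrightarrow> continuous_on UNIV (f t)" and pr: "p \<le> r"
  shows "(\<Sum>n = 2 * p + 1..<2 * Suc r. jump f g (Suc k) n) - (\<Sum>n = p + 1..<Suc r. jump f g k n)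
    = (\<Sum>m = p..<Suc r. jump f g (Suc k) (2 * m + 1) - rt m - lt m) + rt p + lt r"
  using pr
proof (induction r rule: dec_induct)
  case base
  have "{2 * p + 1..<2 * Suc p} = {2 * p + 1}" by auto
  then show ?case by simp
next
  case (step r)
  have e: "dyadic (Suc k) (Suc (Suc (2 * r))) = dyadic k (Suc r)"
    using dyadic_Suc_double[of k "Suc r"] by simp
  have "(\<Sum>n = 2 * p + 1..<2 * Suc (Suc r). jump f g (Suc k) n)
    = (\<Sum>n = 2 * p + 1..<2 * Suc r. jump f g (Suc k) n)
      + jump f g (Suc k) (2 * Suc r) + jump f g (Suc k) (2 * Suc r + 1)"
    using step.hyps by simp
  moreover have "(\<Sum>n = p + 1..<Suc (Suc r). jump f g k n)
    = (\<Sum>n = p + 1..<Suc r. jump f g k n) + jump f g k (Suc r)"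
    using step.hyps by simp
  moreover have "jump f g k (Suc r) = lt r + jump f g (Suc k) (2 * Suc r) + rt (Suc r)"
    using cont[OF dyadic_nonneg]
    by (simp add: jump_def lt_def rt_def h_def h'_def e LBINT_trans)
  moreover have "(\<Sum>m = p..<Suc (Suc r). jump f g (Suc k) (2 * m + 1) - rt m - lt m)
    = (\<Sum>m = p..<Suc r. jump f g (Suc k) (2 * m + 1) - rt m - lt m)
      + (jump f g (Suc k) (2 * Suc r + 1) - rt (Suc r) - lt (Suc r))"
    using step.hyps by simp
  ultimately show ?case using step.IH by linarith
qed

lemma level_mem:
  assumes "2 * ceil_index a m \<le> n" "n \<le> 2 * floor_index b m" "0 \<le> b"
  shows "dyadic (Suc m) n \<in> {a..b}"
proof -
  have "a \<le> dyadic m (ceil_index a m)" using ceil_index_le_iff by blast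
  also have "\<dots> \<le> dyadic (Suc m) n"
    using dyadic_mono[OF assms(1), of "Suc m"] by (simp add: dyadic_Suc_double)
  finally have 1: "a \<le> dyadic (Suc m) n" .
  have "dyadic (Suc m) n \<le> dyadic m (floor_index b m)"
    using dyadic_mono[OF assms(2), of "Suc m"] by (simp add: dyadic_Suc_double)
  also have "\<dots> \<le> b" using le_floor_index_iff[OF assms(3)] by blast
  finally show ?thesis using 1 by simp
qed

lemma half_power_powr: "(1 / 2 ^ k) powr \<alpha> = (2 powr - \<alpha>) ^ k" for \<alpha> :: real
proof -
  have "(1 / 2 ^ k) powr \<alpha> = (2 powr - real k) powr \<alpha>"
    by (simp add: powr_minus powr_realpow inverse_eq_divide)
  also have "\<dots> = (2 powr - \<alpha>) ^ k" by (simp add: powr_powr powr_power mult.commute)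
  finally show ?thesis .
qed

text \<open>
  The integrands under consideration: continuous in space at all times, and on the times \<open>[a, b]\<close> and the positions
  \<open>[-R, R]\<close> bounded by \<open>A\<close> and Hoelder in time with constant \<open>B\<close>. Two separate constants are kept
  because they enter the size of the integral with different powers of \<open>b - a\<close>.
\<close>

definition tame :: "real \<Rightarrow> real \<Rightarrow> real \<Rightarrow> real \<Rightarrow> real \<Rightarrow> real \<Rightarrow> (real \<Rightarrow> real \<Rightarrow> real) \<Rightarrow> bool" where
  "tame \<kappa> R a b A B f \<longleftrightarrow> 0 \<le> A \<and> 0 \<le> B \<and>
     (\<forall>t\<ge>0. continuous_on UNIV (f t)) \<and>
     (\<forall>t\<in>{a..b}. \<forall>\<xi>\<in>{-R..R}. \<bar>f t \<xi>\<bar> \<le> A) \<and>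
     (\<forall>s\<in>{a..b}. \<forall>t\<in>{a..b}. \<forall>\<xi>\<in>{-R..R}. \<bar>f s \<xi> - f t \<xi>\<bar> \<le> B * \<bar>s - t\<bar> powr \<kappa>)"

lemma tame_mono: "tame \<kappa> R a b A B f \<Longrightarrow> a \<le> a' \<Longrightarrow> b' \<le> b \<Longrightarrow> tame \<kappa> R a' b' A B f"
  unfolding tame_def by auto

lemma tameD:
  assumes "tame \<kappa> R a b A B f"
  shows "0 \<le> A" "0 \<le> B" "0 \<le> t \<Longrightarrow> continuous_on UNIV (f t)"
    "t \<in> {a..b} \<Longrightarrow> \<xi> \<in> {-R..R} \<Longrightarrow> \<bar>f t \<xi>\<bar> \<le> A"
    "s \<in> {a..b} \<Longrightarrow> t \<in> {a..b} \<Longrightarrow> \<xi> \<in> {-R..R} \<Longrightarrow> \<bar>f s \<xi> - f t \<xi>\<bar> \<le> B * \<bar>s - t\<bar> powr \<kappa>"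
  using assms unfolding tame_def by blast+

text \<open>
  A component of the driving path. The last assumption is membership in the class \<open>G\<close>, with the
  supremum bounded by \<open>N\<close>.
\<close>

locale scalar_signal =
  fixes g :: "real \<Rightarrow> real" and T \<alpha> C R N \<kappa> \<gamma> :: real
  assumes T: "0 \<le> T" "T \<le> 1" and exponents: "0 < \<alpha>"
    and constants: "0 \<le> C" "0 \<le> N"
    and holder: "s \<in> {0..T} \<Longrightarrow> t \<in> {0..T} \<Longrightarrow> \<bar>g s - g t\<bar> \<le> C * \<bar>s - t\<bar> powr \<alpha>"
    and continuous: "continuous_on {0..T} g"
    and bounded: "s \<in> {0..T} \<Longrightarrow> \<bar>g s\<bar> \<le> R"
    and mu_le: "0 \<le> a \<Longrightarrow> a < b \<Longrightarrow> b \<le> T \<Longrightarrow> mu g a b \<kappa> \<le> ennreal (N * (b - a) powr (\<kappa> + \<gamma>))"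
begin

definition \<rho> :: real where "\<rho> = 2 powr - \<alpha>"

lemma \<rho>: "0 < \<rho>" "\<rho> < 1"
  using exponents by (auto simp: \<rho>_def powr_less_one)

lemma continuous_cell: "dyadic k (n+1) \<le> T \<Longrightarrow> continuous_on {dyadic k n..dyadic k (n+1)} g"
  using dyadic_nonneg[of k n] by (intro continuous_on_subset[OF continuous]) auto

lemma mean_mem:
  assumes "dyadic k (n + 1) \<le> T"
  shows "dyadic_mean g k n \<in> {-R..R}"
proof -
  have "\<bar>dyadic_mean g k n - 0\<bar> \<le> R"
  proof (rule dyadic_mean_near[OF continuous_cell[OF assms]])
    fix s assume "s \<in> {dyadic k n..dyadic k (n+1)}"
    then show "\<bar>g s - 0\<bar> \<le> R" using bounded[of s] assms dyadic_nonneg[of k n] by simp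
  qed
  then show ?thesis by (simp add: abs_le_iff)
qed

lemma mean_near:
  assumes "dyadic k (n + 1) \<le> T" "c \<in> {dyadic k n..dyadic k (n+1)}"
  shows "\<bar>dyadic_mean g k n - g c\<bar> \<le> C * \<rho> ^ k"
proof (rule dyadic_mean_near[OF continuous_cell[OF assms(1)]])
  fix s assume s: "s \<in> {dyadic k n..dyadic k (n+1)}"
  have "\<bar>g s - g c\<bar> \<le> C * \<bar>s - c\<bar> powr \<alpha>"
    using s assms dyadic_nonneg[of k n] by (intro holder) auto
  also have "\<bar>s - c\<bar> \<le> 1 / 2 ^ k" using s assms(2) by (simp add: dyadic_step abs_le_iff)
  then have "C * \<bar>s - c\<bar> powr \<alpha> \<le> C * (1 / 2 ^ k) powr \<alpha>"
    using constants exponents by (intro mult_left_mono powr_mono2) auto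
  finally show "\<bar>g s - g c\<bar> \<le> C * \<rho> ^ k" by (simp add: half_power_powr \<rho>_def)
qed

text \<open>
  Both means are close to the value of \<open>g\<close> at the common end point of the two cells.
\<close>

lemma mean_step:
  assumes "dyadic k (n + 2) \<le> T"
  shows "\<bar>dyadic_mean g k (n + 1) - dyadic_mean g k n\<bar> \<le> 2 * C * \<rho> ^ k"
proof -
  have "dyadic k (n+1) \<le> dyadic k (n+2)" by (rule dyadic_mono) simp
  then have "\<bar>dyadic_mean g k n - g (dyadic k (n+1))\<bar> \<le> C * \<rho> ^ k"
    "\<bar>dyadic_mean g k (n+1) - g (dyadic k (n+1))\<bar> \<le> C * \<rho> ^ k"
    using assms by (auto intro!: mean_near dyadic_mono)
  then show ?thesis by linarith
qed

lemma jump_le: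
  assumes "1 \<le> n" "dyadic k (n + 1) \<le> T" "0 \<le> A" "continuous_on UNIV (f (dyadic k n))"
    and "\<And>\<xi>. \<xi> \<in> {-R..R} \<Longrightarrow> \<bar>f (dyadic k n) \<xi>\<bar> \<le> A"
  shows "\<bar>jump f g k n\<bar> \<le> 2 * A * C * \<rho> ^ k"
proof -
  obtain i where i: "n = i + 1" using assms(1) by (metis add.commute le_Suc_ex)
  have "dyadic k (i + 1) \<le> dyadic k (n + 1)" using i by (intro dyadic_mono) simp
  then have m: "dyadic_mean g k i \<in> {-R..R}" "dyadic_mean g k (i+1) \<in> {-R..R}"
    using assms(2) i by (auto simp del: atLeastAtMost_iff intro!: mean_mem)
  have "\<bar>jump f g k n\<bar> \<le> A * \<bar>dyadic_mean g k (i+1) - dyadic_mean g k i\<bar>"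
    using LBINT_abs_le[OF assms(4,5) m] by (simp add: jump_def i)
  also have "\<dots> \<le> A * (2 * C * \<rho> ^ k)"
    using assms(2,3) i by (intro mult_left_mono mean_step) auto
  finally show ?thesis by (simp add: mult_ac)
qed

text \<open>
  The mean over the cell is the midpoint of the means over its halves. Hence the jump between the latter,
  evaluated at the time \<open>s\<close> in the middle of the cell, and the two pieces that it is compared with run over the same segment, and their
  integrands belong to times at distance \<open>1 / 2 ^ Suc k\<close>.
\<close>

lemma odd_jump_le:
  assumes tame: "tame \<kappa> R a b A B f" and ab: "0 \<le> a" "b \<le> T"
    and m: "dyadic k m \<in> {a..b}" "dyadic k (Suc m) \<in> {a..b}"
  shows "\<bar>jump f g (Suc k) (2 * m + 1)
      - (LBINT \<xi>=dyadic_mean g (Suc k) (2 * m)..dyadic_mean g k m. f (dyadic k m) \<xi>)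
      - (LBINT \<xi>=dyadic_mean g k m..dyadic_mean g (Suc k) (2 * m + 1). f (dyadic k (Suc m)) \<xi>)\<bar>
    \<le> B * (1 / 2 ^ Suc k) powr \<kappa> * \<bar>dyadic_mean g (Suc k) (2 * m) - dyadic_mean g (Suc k) (2 * m + 1)\<bar>"
proof -
  define u v w where "u = dyadic_mean g (Suc k) (2 * m)" and "v = dyadic_mean g k m"
    and "w = dyadic_mean g (Suc k) (2 * m + 1)"
  define s where "s = dyadic (Suc k) (2 * m + 1)"
  have smT: "dyadic k (m+1) \<le> T" using m ab by simp
  have s1: "dyadic k m = s - 1 / 2 ^ Suc k" "dyadic k (Suc m) = s + 1 / 2 ^ Suc k"
    by (simp_all add: s_def dyadic_def field_simps)
  have "0 \<le> 1 / (2::real) ^ Suc k" by simp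
  then have s: "s \<in> {a..b}" using m unfolding s1 atLeastAtMost_iff by linarith
  have mid: "v = (u + w) / 2"
    unfolding u_def v_def w_def by (rule dyadic_mean_halve[OF continuous_cell[OF smT]])
  have d: "dyadic (Suc k) (2 * m + 1 + 1) = dyadic k (m + 1)"
    using dyadic_Suc_double[of k "m+1"] by simp
  have "dyadic (Suc k) (2 * m + 1) \<le> dyadic (Suc k) (2 * m + 1 + 1)" by (rule dyadic_mono) simp
  then have mem: "u \<in> {-R..R}" "v \<in> {-R..R}" "w \<in> {-R..R}"
    unfolding u_def v_def w_def using smT d
    by (auto simp del: atLeastAtMost_iff intro!: mean_mem)
  let ?e = "B * (1 / 2 ^ Suc k) powr \<kappa>"
  have c: "continuous_on UNIV (f s)" "continuous_on UNIV (f (dyadic k m))" "continuous_on UNIV (f (dyadic k (Suc m)))"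
    using tameD(3)[OF tame] s m ab by auto
  have e: "\<bar>f s \<xi> - f t \<xi>\<bar> \<le> ?e" if "\<xi> \<in> {-R..R}" "t \<in> {a..b}" "\<bar>s - t\<bar> = 1 / 2 ^ Suc k" for t \<xi>
    using tameD(5)[OF tame s that(2,1)] that(3) by simp
  have "jump f g (Suc k) (2 * m + 1) = (LBINT \<xi>=ereal u..ereal v. f s \<xi>) + (LBINT \<xi>=ereal v..ereal w. f s \<xi>)"
    unfolding LBINT_trans[OF c(1)] by (simp add: jump_def u_def v_def w_def s_def)
  then have "jump f g (Suc k) (2 * m + 1) - (LBINT \<xi>=u..v. f (dyadic k m) \<xi>) - (LBINT \<xi>=v..w. f (dyadic k (Suc m)) \<xi>)
    = (LBINT \<xi>=ereal u..ereal v. f s \<xi> - f (dyadic k m) \<xi>) + (LBINT \<xi>=ereal v..ereal w. f s \<xi> - f (dyadic k (Suc m)) \<xi>)"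
    using c by (simp add: LBINT_diff)
  also have "\<bar>\<dots>\<bar> \<le> ?e * \<bar>v - u\<bar> + ?e * \<bar>w - v\<bar>"
  proof (rule order_trans[OF abs_triangle_ineq], rule add_mono)
    show "\<bar>LBINT \<xi>=ereal u..ereal v. f s \<xi> - f (dyadic k m) \<xi>\<bar> \<le> ?e * \<bar>v - u\<bar>"
      by (rule LBINT_abs_le[OF _ _ mem(1,2)]) (use c e m s1 in \<open>auto intro!: continuous_on_diff\<close>)
    show "\<bar>LBINT \<xi>=ereal v..ereal w. f s \<xi> - f (dyadic k (Suc m)) \<xi>\<bar> \<le> ?e * \<bar>w - v\<bar>"
      by (rule LBINT_abs_le[OF _ _ mem(2,3)]) (use c e m s1 in \<open>auto intro!: continuous_on_diff\<close>)
  qed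
  also have "\<dots> = ?e * \<bar>u - w\<bar>"
  proof -
    have "\<bar>v - u\<bar> + \<bar>w - v\<bar> = \<bar>u - w\<bar>" unfolding mid by (simp add: abs_if field_simps)
    then show ?thesis by (simp flip: distrib_left)
  qed
  finally show ?thesis by (simp add: u_def v_def w_def)
qed

text \<open>
  The cells of level \<open>m + 1\<close> in \<open>[a, b]\<close> are the halves of those of level \<open>m\<close> and up to one further cell at
  each end, which contributes two jumps of level \<open>m + 2\<close>. Together with the two unpaired pieces in
  \<open>jump_refinement\<close> this gives six terms of size \<open>2 * A * C * \<rho> ^ Suc (Suc m)\<close>.
\<close>

lemma refinement_le:
  assumes tame: "tame \<kappa> R a b A B f" and ab: "0 \<le> a" "a \<le> b" "b \<le> T" and ne: "ceil_index a m < floor_index b m"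
  shows "\<bar>dyadic_sum f g a b (Suc (Suc m)) - dyadic_sum f g a b (Suc m)\<bar>
    \<le> B * (1 / 2 ^ Suc (Suc m)) powr \<kappa> * (\<Sum>i = 2 * ceil_index a m..<2 * floor_index b m.
         \<bar>dyadic_mean g (Suc (Suc m)) (2 * i) - dyadic_mean g (Suc (Suc m)) (2 * i + 1)\<bar>)
      + 12 * A * C * \<rho> ^ Suc (Suc m)"
proof -
  have b: "0 \<le> b" "b \<le> 1" using ab T by auto
  define k where "k = Suc m"
  define p q where "p = 2 * ceil_index a m" and "q = 2 * floor_index b m"
  define p' q' where "p' = ceil_index a k" and "q' = floor_index b k"
  have rf: "p' \<le> p" "p \<le> p' + 1" "q \<le> q'" "q' \<le> q + 1"
    using ceil_index_refine[of a m] floor_index_refine[OF b(1), of m] by (simp_all add: p_def q_def p'_def q'_def k_def)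
  obtain r where r: "q = Suc r" "p \<le> r"
    using ne unfolding p_def q_def by (metis Suc_diff_1 le_neq_implies_less less_imp_le less_Suc_eq_le
      mult_less_mono2 not_less_zero not_gr_zero zero_less_numeral)
  let ?j = "jump f g (Suc k)"
  let ?S = "\<Sum>n = p + 1..<q. jump f g k n"
  let ?M = "\<Sum>n = 2 * p + 1..<2 * q. ?j n"
  let ?S' = "\<Sum>n = 2 * p' + 1..<2 * q'. ?j n"
  define h h' where "h = dyadic_mean g k" and "h' = dyadic_mean g (Suc k)"
  define rt where "rt m = (LBINT \<xi>=h' (2 * m)..h m. f (dyadic k m) \<xi>)" for m
  define lt where "lt m = (LBINT \<xi>=h m..h' (2 * m + 1). f (dyadic k (Suc m)) \<xi>)" for m
  let ?X = "2 * A * C * \<rho> ^ Suc k"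
  have Ap: "0 \<le> A" using tameD(1)[OF tame] .
  have Xp: "0 \<le> ?X" using Ap constants \<rho> by simp
  have mem: "dyadic k n \<in> {a..b}" if "p \<le> n" "n \<le> q" for n
    using level_mem[of a m n b] that b unfolding k_def p_def q_def by blast
  have mem': "dyadic (Suc k) n \<in> {a..b}" if "2 * p' \<le> n" "n \<le> 2 * q'" for n
    using level_mem[of a k n b] that b unfolding p'_def q'_def by blast
  \<comment> \<open>The jumps of level \<open>Suc k\<close> outside the range that refines the cells of level \<open>k\<close>.\<close>
  have "?S' - ?M = sum ?j ({2 * p' + 1..<2 * q'} - {2 * p + 1..<2 * q})"
    using rf by (subst sum_diff) auto
  also have "\<bar>\<dots>\<bar> \<le> of_nat (card ({2 * p' + 1..<2 * q'} - {2 * p + 1..<2 * q})) * ?X"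
  proof (rule order_trans[OF sum_abs], rule sum_bounded_above)
    fix n assume "n \<in> {2 * p' + 1..<2 * q'} - {2 * p + 1..<2 * q}"
    then have n: "1 \<le> n" "2 * p' \<le> n" "n + 1 \<le> 2 * q'" by auto
    show "\<bar>?j n\<bar> \<le> ?X"
    proof (rule jump_le[OF n(1)])
      show "dyadic (Suc k) (n+1) \<le> T" using mem'[of "n+1"] n ab by auto
      have "dyadic (Suc k) n \<in> {a..b}" using mem'[of n] n by simp
      then show "\<bar>f (dyadic (Suc k) n) \<xi>\<bar> \<le> A" if "\<xi> \<in> {-R..R}" for \<xi>
        using tameD(4)[OF tame] that by blast
    qed (use Ap tameD(3)[OF tame dyadic_nonneg] in auto)
  qed
  also have "\<dots> \<le> 4 * ?X"
  proof (rule mult_right_mono[OF _ Xp])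
    have "card ({2 * p' + 1..<2 * q'} - {2 * p + 1..<2 * q}) = (2 * q' - (2 * p' + 1)) - (2 * q - (2 * p + 1))"
      using rf by (subst card_Diff_subset) auto
    also have "\<dots> \<le> 4" using rf r by linarith
    finally show "real (card ({2 * p' + 1..<2 * q'} - {2 * p + 1..<2 * q})) \<le> 4" by simp
  qed
  finally have 1: "\<bar>?S' - ?M\<bar> \<le> 4 * ?X" .
  have half: "\<bar>h' (2 * i) - h i\<bar> \<le> 2 * C * \<rho> ^ Suc k" "\<bar>h' (2 * i + 1) - h i\<bar> \<le> 2 * C * \<rho> ^ Suc k"
    "h i \<in> {-R..R}" "h' (2 * i) \<in> {-R..R}" "h' (2 * i + 1) \<in> {-R..R}"
    if "p \<le> i" "i < q" for i
  proof -
    have t: "dyadic k (i + 1) \<le> T" using mem[of "i+1"] that ab by auto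
    have e: "dyadic (Suc k) (2 * i + 1 + 1) = dyadic k (i + 1)" "dyadic (Suc k) (2 * i + 2) = dyadic k (i + 1)"
      using dyadic_Suc_double[of k "i+1"] by simp_all
    have "h i = (h' (2 * i) + h' (2 * i + 1)) / 2"
      unfolding h_def h'_def by (rule dyadic_mean_halve[OF continuous_cell[OF t]])
    moreover have "\<bar>h' (2 * i + 1) - h' (2 * i)\<bar> \<le> 2 * C * \<rho> ^ Suc k"
      unfolding h'_def by (rule mean_step) (use t e in simp)
    ultimately have "\<bar>h' (2 * i) - h i\<bar> \<le> 2 * C * \<rho> ^ Suc k \<and> \<bar>h' (2 * i + 1) - h i\<bar> \<le> 2 * C * \<rho> ^ Suc k"
      by (auto simp: abs_le_iff field_simps)
    then show "\<bar>h' (2 * i) - h i\<bar> \<le> 2 * C * \<rho> ^ Suc k" "\<bar>h' (2 * i + 1) - h i\<bar> \<le> 2 * C * \<rho> ^ Suc k"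
      by blast+
    have "dyadic (Suc k) (2 * i + 1) \<le> dyadic (Suc k) (2 * i + 1 + 1)" by (rule dyadic_mono) simp
    then show "h i \<in> {-R..R}" "h' (2 * i) \<in> {-R..R}" "h' (2 * i + 1) \<in> {-R..R}"
      unfolding h_def h'_def using t e(1)
      by (auto simp del: atLeastAtMost_iff intro!: mean_mem)
  qed
  have "\<bar>rt p\<bar> \<le> A * \<bar>h p - h' (2 * p)\<bar>"
    unfolding rt_def
  proof (rule LBINT_abs_le[OF _ _ half(4,3)])
    show "\<bar>f (dyadic k p) \<xi>\<bar> \<le> A" if "\<xi> \<in> {-R..R}" for \<xi>
      using tameD(4)[OF tame mem that] r by simp
  qed (use tameD(3)[OF tame dyadic_nonneg] r in auto)
  also have "\<dots> \<le> A * (2 * C * \<rho> ^ Suc k)"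
    using half(1)[of p] r by (intro mult_left_mono Ap) (simp add: abs_minus_commute)
  finally have 2: "\<bar>rt p\<bar> \<le> ?X" by (simp add: mult_ac)
  have "\<bar>lt r\<bar> \<le> A * \<bar>h' (2 * r + 1) - h r\<bar>"
    unfolding lt_def
  proof (rule LBINT_abs_le[OF _ _ half(3,5)])
    show "\<bar>f (dyadic k (Suc r)) \<xi>\<bar> \<le> A" if "\<xi> \<in> {-R..R}" for \<xi>
      using tameD(4)[OF tame mem that] r by simp
  qed (use tameD(3)[OF tame dyadic_nonneg] r in auto)
  also have "\<dots> \<le> A * (2 * C * \<rho> ^ Suc k)"
    using half(2)[of r] r by (intro mult_left_mono Ap) simp
  finally have 3: "\<bar>lt r\<bar> \<le> ?X" by (simp add: mult_ac)
  let ?E = "\<lambda>i. ?j (2 * i + 1) - rt i - lt i"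
  have 4: "?M - ?S = (\<Sum>i = p..<q. ?E i) + rt p + lt r"
    unfolding r(1) rt_def lt_def h_def h'_def
    by (rule jump_refinement[OF tameD(3)[OF tame] r(2)])
  have "\<bar>\<Sum>i = p..<q. ?E i\<bar> \<le> (\<Sum>i = p..<q. B * (1 / 2 ^ Suc k) powr \<kappa> * \<bar>h' (2 * i) - h' (2 * i + 1)\<bar>)"
  proof (rule order_trans[OF sum_abs], rule sum_mono)
    fix i assume "i \<in> {p..<q}"
    then show "\<bar>?E i\<bar> \<le> B * (1 / 2 ^ Suc k) powr \<kappa> * \<bar>h' (2 * i) - h' (2 * i + 1)\<bar>"
      unfolding rt_def lt_def h_def h'_def by (intro odd_jump_le[OF tame ab(1,3)] mem) auto
  qed
  also have "\<dots> = B * (1 / 2 ^ Suc k) powr \<kappa> * (\<Sum>i = p..<q. \<bar>h' (2 * i) - h' (2 * i + 1)\<bar>)"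
    by (simp add: sum_distrib_left)
  finally have "\<bar>?S' - ?S\<bar> \<le> B * (1 / 2 ^ Suc k) powr \<kappa> * (\<Sum>i = p..<q. \<bar>h' (2 * i) - h' (2 * i + 1)\<bar>) + 6 * ?X"
    using 1 2 3 4 Xp by linarith
  moreover have "dyadic_sum f g a b (Suc k) = ?S'" "dyadic_sum f g a b k = ?S"
    unfolding k_def p_def q_def p'_def q'_def by (rule dyadic_sum_eq[OF b])+
  ultimately show ?thesis unfolding p_def q_def k_def h'_def by (simp add: algebra_simps)
qed

end

section \<open>Convergence, size and additivity of the dyadic integral\<close>

lemma increments_summable_convergent:
  fixes s u :: "nat \<Rightarrow> real"
  assumes inc: "\<And>i. \<bar>s (Suc i) - s i\<bar> \<le> u i" and u: "summable u"
  shows "convergent s" "\<bar>lim s - s 0\<bar> \<le> suminf u"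
proof -
  have d: "summable (\<lambda>i. s (Suc i) - s i)"
    by (rule summable_comparison_test'[OF u]) (use inc in auto)
  have "(\<lambda>n. \<Sum>i<n. s (Suc i) - s i) \<longlonglongrightarrow> (\<Sum>i. s (Suc i) - s i)"
    using summable_LIMSEQ[OF d] .
  then have "(\<lambda>n. (s n - s 0) + s 0) \<longlonglongrightarrow> (\<Sum>i. s (Suc i) - s i) + s 0"
    by (intro tendsto_add tendsto_const) (simp add: sum_lessThan_telescope)
  then have lim: "s \<longlonglongrightarrow> (\<Sum>i. s (Suc i) - s i) + s 0" by simp
  then show "convergent s" by (rule convergentI)
  have "lim s - s 0 = (\<Sum>i. s (Suc i) - s i)" using limI[OF lim] by simp
  moreover have "summable (\<lambda>i. \<bar>s (Suc i) - s i\<bar>)"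
    by (rule summable_comparison_test'[OF u]) (use inc in auto)
  ultimately show "\<bar>lim s - s 0\<bar> \<le> suminf u"
    using summable_rabs[of "\<lambda>i. s (Suc i) - s i"] suminf_le[OF inc _ u] by fastforce
qed

lemma dyadic_sum_tendsto_iff:
  assumes "\<And>m. dyadic_sum f g a b (Suc m) = S m"
  shows "dyadic_sum f g a b \<longlonglongrightarrow> I \<longleftrightarrow> S \<longlonglongrightarrow> I"
  using filterlim_sequentially_Suc[of "dyadic_sum f g a b" "nhds I"] assms by simp

lemma dyadic_integral_cong:
  assumes ab: "0 \<le> b" "b \<le> 1" and eq: "\<And>t \<xi>. t \<in> {a..b} \<Longrightarrow> f t \<xi> = f' t \<xi>"
  shows "dyadic_integrable f g a b \<longleftrightarrow> dyadic_integrable f' g a b"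
    "dyadic_integral f g a b = dyadic_integral f' g a b"
proof -
  have "dyadic_sum f g a b (Suc m) = dyadic_sum f' g a b (Suc m)" for m
    unfolding dyadic_sum_eq[OF ab]
  proof (rule sum.cong[OF refl])
    fix n assume "n \<in> {2 * ceil_index a m + 1..<2 * floor_index b m}"
    then have "dyadic (Suc m) n \<in> {a..b}" using ab by (intro level_mem) auto
    then have "f (dyadic (Suc m) n) = f' (dyadic (Suc m) n)" using eq by blast
    then show "jump f g (Suc m) n = jump f' g (Suc m) n" unfolding jump_def by simp
  qed
  then have "dyadic_sum f g a b \<longlonglongrightarrow> I \<longleftrightarrow> dyadic_sum f' g a b \<longlonglongrightarrow> I" for I
    using dyadic_sum_tendsto_iff[of f g a b "\<lambda>m. dyadic_sum f' g a b (Suc m)" I]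
      dyadic_sum_tendsto_iff[of f' g a b "\<lambda>m. dyadic_sum f' g a b (Suc m)" I] by simp
  then show "dyadic_integrable f g a b \<longleftrightarrow> dyadic_integrable f' g a b"
    "dyadic_integral f g a b = dyadic_integral f' g a b"
    by (simp_all add: dyadic_integrable_def dyadic_integral_def convergent_def lim_def)
qed

lemma dyadic_integral_diff:
  assumes ab: "0 \<le> b" "b \<le> 1"
    and c: "\<And>t. 0 \<le> t \<Longrightarrow> continuous_on UNIV (f t)" "\<And>t. 0 \<le> t \<Longrightarrow> continuous_on UNIV (f' t)"
    and int: "dyadic_integrable f g a b" "dyadic_integrable f' g a b"
  shows "dyadic_integral (\<lambda>t \<xi>. f t \<xi> - f' t \<xi>) g a b = dyadic_integral f g a b - dyadic_integral f' g a b"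
proof -
  have "dyadic_sum (\<lambda>t \<xi>. f t \<xi> - f' t \<xi>) g a b (Suc m) = dyadic_sum f g a b (Suc m) - dyadic_sum f' g a b (Suc m)" for m
    unfolding dyadic_sum_eq[OF ab] jump_def
    by (simp add: LBINT_diff c dyadic_nonneg sum_subtractf)
  moreover have "(\<lambda>m. dyadic_sum f g a b (Suc m) - dyadic_sum f' g a b (Suc m))
      \<longlonglongrightarrow> dyadic_integral f g a b - dyadic_integral f' g a b"
    using int[unfolded dyadic_integrable_def convergent_LIMSEQ_iff] unfolding dyadic_integral_def
    by (intro tendsto_diff LIMSEQ_Suc)
  ultimately show ?thesis
    unfolding dyadic_integral_def[of "\<lambda>t \<xi>. f t \<xi> - f' t \<xi>"]
    by (intro limI) (simp add: dyadic_sum_tendsto_iff)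
qed

lemma ceil_index_less_floor_index:
  assumes "0 \<le> a" "0 \<le> b" "a * 2 ^ m + 2 < b * 2 ^ m"
  shows "ceil_index a m < floor_index b m"
proof -
  have "0 \<le> a * 2 ^ m" "0 \<le> b * 2 ^ m" using assms by auto
  then have "real (ceil_index a m) < a * 2 ^ m + 1" "b * 2 ^ m - 1 < real (floor_index b m)"
    unfolding ceil_index_def floor_index_def by linarith+
  then have "real (ceil_index a m) < real (floor_index b m)" using assms(3) by linarith
  then show ?thesis by simp
qed

lemma floor_index_near_ceil_index:
  assumes "0 \<le> c"
  shows "floor_index c m \<le> ceil_index c m" "ceil_index c m \<le> floor_index c m + 1"
proof -
  have "0 \<le> c * 2 ^ m" using assms by simp
  then show "floor_index c m \<le> ceil_index c m" "ceil_index c m \<le> floor_index c m + 1"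
    unfolding ceil_index_def floor_index_def by linarith+
qed

lemma dyadic_sum_trivial_interval:
  assumes "0 \<le> a" "a \<le> 1"
  shows "dyadic_integrable f g a a" "dyadic_integral f g a a = 0"
proof -
  have "dyadic_sum f g a a (Suc m) = 0" for m
  proof -
    have "{2 * ceil_index a m + 1..<2 * floor_index a m} = {}" using floor_index_near_ceil_index(1)[OF assms(1), of m] by simp
    then show ?thesis unfolding dyadic_sum_eq[OF assms] by (simp only: sum.empty)
  qed
  then have "dyadic_sum f g a a \<longlonglongrightarrow> 0"
    using dyadic_sum_tendsto_iff[of f g a a "\<lambda>m. 0" 0] by simp
  then show "dyadic_integrable f g a a" "dyadic_integral f g a a = 0"
    by (auto simp: dyadic_integrable_def dyadic_integral_def convergent_def limI)
qed

text \<open>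
  The series in \<open>mu\<close> starts right after the first level whose cells are shorter than the interval.
\<close>

lemma dyadic_scale:
  fixes l :: real assumes "0 < l" "l \<le> 1"
  defines "k \<equiv> nat \<lfloor>log 2 (2 / l)\<rfloor>"
  shows "1 / 2 ^ k < l" "l * 2 ^ k \<le> 2"
proof -
  have pos: "2 / l > 0" "2 / l \<ge> 1" using assms by (auto simp: field_simps)
  then have "0 \<le> log 2 (2 / l)" by simp
  then have k: "\<lfloor>log 2 (2 / l)\<rfloor> = int k" unfolding k_def by simp
  have "2 powr real_of_int (int k) \<le> 2 / l \<and> 2 / l < 2 powr (real_of_int (int k) + 1)"
    using floor_log_eq_powr_iff[of "2 / l" 2 "int k"] pos k by simp
  then have "2 ^ k \<le> 2 / l" "2 / l < 2 * 2 ^ k" by (simp_all add: powr_add powr_realpow)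
  then show "1 / 2 ^ k < l" "l * 2 ^ k \<le> 2" using assms by (simp_all add: field_simps)
qed

context scalar_signal
begin

text \<open>
  The inner sum in the definition of \<open>mu\<close>.
\<close>

definition cell_variation :: "real \<Rightarrow> real \<Rightarrow> nat \<Rightarrow> real" where
  "cell_variation a b k = (\<Sum>n\<in>{n. 1 \<le> n \<and> {dyadic k (n - 1)..dyadic k n} \<subseteq> {a..b}}.
     \<bar>dyadic_mean g (k + 1) (2 * (n - 1)) - dyadic_mean g (k + 1) (2 * (n - 1) + 1)\<bar>)"

lemma cell_variation_ge:
  assumes "0 \<le> b"
  shows "(\<Sum>i = 2 * ceil_index a m..<2 * floor_index b m.
         \<bar>dyadic_mean g (Suc (Suc m)) (2 * i) - dyadic_mean g (Suc (Suc m)) (2 * i + 1)\<bar>)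
    \<le> cell_variation a b (Suc m)"
proof -
  let ?I = "{2 * ceil_index a m..<2 * floor_index b m}"
  let ?J = "{n. 1 \<le> n \<and> {dyadic (Suc m) (n - 1)..dyadic (Suc m) n} \<subseteq> {a..b}}"
  let ?d = "\<lambda>i. \<bar>dyadic_mean g (Suc (Suc m)) (2 * i) - dyadic_mean g (Suc (Suc m)) (2 * i + 1)\<bar>"
  have fin: "finite ?J"
  proof (rule finite_subset)
    show "?J \<subseteq> {..floor_index b (Suc m)}"
    proof
      fix n assume n: "n \<in> ?J"
      then have "dyadic (Suc m) n \<in> {dyadic (Suc m) (n - 1)..dyadic (Suc m) n}"
        by (auto intro: dyadic_mono)
      then have "dyadic (Suc m) n \<le> b" using n by fastforce
      then show "n \<in> {..floor_index b (Suc m)}" by (simp add: le_floor_index_iff[OF assms])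
    qed
  qed simp
  have "(\<Sum>i\<in>?I. ?d i) = (\<Sum>n\<in>Suc ` ?I. ?d (n - 1))" by (subst sum.reindex) auto
  also have "\<dots> \<le> (\<Sum>n\<in>?J. ?d (n - 1))"
  proof (rule sum_mono2[OF fin])
    show "Suc ` ?I \<subseteq> ?J"
    proof (rule image_subsetI)
      fix i assume i: "i \<in> ?I"
      have "dyadic (Suc m) i \<in> {a..b}" "dyadic (Suc m) (Suc i) \<in> {a..b}"
        using i assms by (auto simp del: atLeastAtMost_iff intro!: level_mem)
      then show "Suc i \<in> ?J" by auto
    qed
  qed simp
  finally show ?thesis by (simp add: cell_variation_def)
qed

lemma cell_variation_summable:
  assumes ab: "0 \<le> a" "a < b" "b \<le> T"
  defines "k0 \<equiv> nat \<lfloor>log 2 (2 / (b - a))\<rfloor>"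
  defines "w \<equiv> \<lambda>i. 2 powr (- (real (k0 + 1 + i + 1) * \<kappa>)) * cell_variation a b (k0 + 1 + i)"
  shows "summable w" "suminf w \<le> N * (b - a) powr (\<kappa> + \<gamma>)"
proof -
  let ?X = "N * (b - a) powr (\<kappa> + \<gamma>)"
  have X: "0 \<le> ?X" using constants by simp
  have w0: "0 \<le> w i" for i unfolding w_def cell_variation_def by (intro mult_nonneg_nonneg sum_nonneg) auto
  have mu: "mu g a b \<kappa> = (\<Sum>i. ennreal (w i))"
    unfolding mu_def w_def k0_def cell_variation_def Let_def by simp
  then have le: "(\<Sum>i. ennreal (w i)) \<le> ennreal ?X" using mu_le[OF ab] by simp
  then have fin: "(\<Sum>i. ennreal (w i)) \<noteq> top" by (auto simp: top_unique)
  show "summable w" using summable_suminf_not_top[OF w0 fin] .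
  then show "suminf w \<le> ?X" using le suminf_ennreal2[OF w0] X suminf_nonneg[OF _ w0] by simp
qed

definition integral_const :: real where "integral_const = (16 + 12 / (1 - \<rho>)) * C + N"

lemma integral_const_nonneg: "0 \<le> integral_const" using \<rho> constants by (simp add: integral_const_def)

text \<open>
  The sums are compared with the one of level \<open>k0 + 2\<close>: from there on at least one cell fits into
  the interval, so \<open>refinement_le\<close> applies, while at this level there are still at most eight jumps. All end
  terms are geometric with ratio \<open>\<rho>\<close> and start at size \<open>(b - a) powr \<alpha>\<close>; the others sum up to the series in
  \<open>mu\<close>.
\<close>

lemma dyadic_integral_exists_le:
  assumes tame: "tame \<kappa> R a b A B f" and ab: "0 \<le> a" "a \<le> b" "b \<le> T"
  shows "dyadic_integrable f g a b"
    "\<bar>dyadic_integral f g a b\<bar> \<le> integral_const * (A * (b - a) powr \<alpha> + B * (b - a) powr (\<kappa> + \<gamma>))"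
proof -
  have A: "0 \<le> A" "0 \<le> B" using tameD[OF tame] by auto
  have b: "0 \<le> b" "b \<le> 1" using ab T by auto
  have "dyadic_integrable f g a b \<and>
    \<bar>dyadic_integral f g a b\<bar> \<le> integral_const * (A * (b - a) powr \<alpha> + B * (b - a) powr (\<kappa> + \<gamma>))"
  proof (cases "a = b")
    case True
    then show ?thesis
      using dyadic_sum_trivial_interval[of b f g] b A integral_const_nonneg by simp
  next
    case False
    then have ab': "a < b" using ab by simp
    define k0 where "k0 = nat \<lfloor>log 2 (2 / (b - a))\<rfloor>"
    define w where "w i = 2 powr (- (real (k0 + 1 + i + 1) * \<kappa>)) * cell_variation a b (k0 + 1 + i)" for i
    note w = cell_variation_summable[OF ab(1) ab' ab(3), folded k0_def, folded w_def]
    have w0: "0 \<le> w i" for i unfolding w_def cell_variation_def by (intro mult_nonneg_nonneg sum_nonneg) auto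
    have sc: "1 / 2 ^ k0 < b - a" "(b - a) * 2 ^ k0 \<le> 2"
      unfolding k0_def using dyadic_scale[of "b - a"] ab' ab b by auto
    define s where "s i = dyadic_sum f g a b (k0 + 2 + i)" for i
    define u where "u i = B * w (Suc i) + 12 * A * C * \<rho> ^ (k0 + 3) * \<rho> ^ i" for i
    have inc: "\<bar>s (Suc i) - s i\<bar> \<le> u i" for i
    proof -
      define m where "m = k0 + 1 + i"
      have "2 ^ k0 * (2::real) \<le> 2 ^ m" unfolding m_def by (simp add: power_add)
      then have "(b - a) * (2 ^ k0 * 2) \<le> (b - a) * 2 ^ m" using ab' by (intro mult_left_mono) auto
      moreover have "(b - a) * 2 ^ k0 > 1" using sc(1) by (simp add: field_simps)
      ultimately have "b * 2 ^ m - a * 2 ^ m > 2" by (simp add: algebra_simps)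
      then have ne: "ceil_index a m < floor_index b m" using ab b by (intro ceil_index_less_floor_index) auto
      have "\<bar>s (Suc i) - s i\<bar> = \<bar>dyadic_sum f g a b (Suc (Suc m)) - dyadic_sum f g a b (Suc m)\<bar>"
        by (simp add: s_def m_def)
      also have "\<dots> \<le> B * (1 / 2 ^ Suc (Suc m)) powr \<kappa> * cell_variation a b (Suc m) + 12 * A * C * \<rho> ^ Suc (Suc m)"
        by (rule order_trans[OF refinement_le[OF tame ab ne]])
          (intro add_mono order_refl mult_left_mono cell_variation_ge, use A b in auto)
      also have "(1 / 2 ^ Suc (Suc m)) powr \<kappa> = 2 powr (- (real (k0 + 1 + Suc i + 1) * \<kappa>))"
      proof -
        have "(1 / 2 ^ Suc (Suc m)) powr \<kappa> = (2 powr - real (Suc (Suc m))) powr \<kappa>"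
          by (simp only: powr_minus powr_realpow inverse_eq_divide zero_less_numeral)
        then show ?thesis by (simp add: powr_powr m_def algebra_simps)
      qed
      also have "B * 2 powr (- (real (k0 + 1 + Suc i + 1) * \<kappa>)) * cell_variation a b (Suc m) = B * w (Suc i)"
        by (simp add: w_def m_def)
      also have "12 * A * C * \<rho> ^ Suc (Suc m) = 12 * A * C * \<rho> ^ (k0 + 3) * \<rho> ^ i"
      proof -
        have "Suc (Suc m) = (k0 + 3) + i" by (simp add: m_def)
        then show ?thesis by (simp only: power_add mult.assoc)
      qed
      finally show ?thesis by (simp add: u_def)
    qed
    have sw: "summable (\<lambda>i. w (Suc i))" using w(1) by (simp only: summable_Suc_iff)
    have sr: "summable (\<lambda>i. \<rho> ^ i)" using \<rho> by (intro summable_geometric) simp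
    have su: "summable u" unfolding u_def by (intro summable_add summable_mult sw sr)
    have l0: "\<rho> ^ k0 \<le> (b - a) powr \<alpha>"
    proof -
      have "(1 / 2 ^ k0) powr \<alpha> \<le> (b - a) powr \<alpha>" using sc exponents by (intro powr_mono2) auto
      then show ?thesis by (simp add: half_power_powr \<rho>_def)
    qed
    have l1: "\<rho> ^ (k0 + i) \<le> (b - a) powr \<alpha>" for i
    proof -
      have "\<rho> ^ (k0 + i) \<le> \<rho> ^ k0" by (rule power_decreasing) (use \<rho> in auto)
      then show ?thesis using l0 by linarith
    qed
    have "suminf u = B * (\<Sum>i. w (Suc i)) + 12 * A * C * \<rho> ^ (k0 + 3) * (1 / (1 - \<rho>))"
      unfolding u_def using \<rho>
      by (simp add: suminf_add[symmetric] summable_mult sw sr suminf_mult suminf_geometric)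
    also have "\<dots> \<le> B * (N * (b - a) powr (\<kappa> + \<gamma>)) + 12 * A * C * (b - a) powr \<alpha> * (1 / (1 - \<rho>))"
    proof (intro add_mono mult_left_mono mult_right_mono)
      have "(\<Sum>i. w (Suc i)) \<le> suminf w" using suminf_split_head[OF w(1)] w0[of 0] by simp
      then show "(\<Sum>i. w (Suc i)) \<le> N * (b - a) powr (\<kappa> + \<gamma>)" using w(2) by linarith
    qed (use A constants \<rho> l1 in auto)
    finally have 1: "suminf u \<le> B * (N * (b - a) powr (\<kappa> + \<gamma>)) + 12 * A * C * (b - a) powr \<alpha> * (1 / (1 - \<rho>))" .
    have 2: "\<bar>s 0\<bar> \<le> 16 * A * C * (b - a) powr \<alpha>"
    proof -
      define m where "m = k0 + 1"
      define p q where "p = 2 * ceil_index a m" and "q = 2 * floor_index b m"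
      have "s 0 = (\<Sum>n = p + 1..<q. jump f g (Suc m) n)"
        unfolding s_def p_def q_def using dyadic_sum_eq[OF b, of f g a m] by (simp add: m_def)
      also have "\<bar>\<dots>\<bar> \<le> of_nat (card {p + 1..<q}) * (2 * A * C * \<rho> ^ Suc m)"
      proof (rule order_trans[OF sum_abs], rule sum_bounded_above)
        fix n assume n: "n \<in> {p + 1..<q}"
        have mem: "dyadic (Suc m) n \<in> {a..b}" "dyadic (Suc m) (n+1) \<in> {a..b}"
          using n b unfolding p_def q_def by (auto simp del: atLeastAtMost_iff intro!: level_mem)
        show "\<bar>jump f g (Suc m) n\<bar> \<le> 2 * A * C * \<rho> ^ Suc m"
        proof (rule jump_le)
          show "\<bar>f (dyadic (Suc m) n) \<xi>\<bar> \<le> A" if "\<xi> \<in> {-R..R}" for \<xi>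
            using tameD(4)[OF tame mem(1) that] .
        qed (use n mem A ab tameD(3)[OF tame dyadic_nonneg] in auto)
      qed
      also have "\<dots> \<le> 8 * (2 * A * C * (b - a) powr \<alpha>)"
      proof (intro mult_mono mult_left_mono)
        have "(b - a) * 2 ^ m \<le> 4" using sc by (simp add: m_def)
        then have "b * 2 ^ m \<le> a * 2 ^ m + 4" by (simp add: algebra_simps)
        moreover have "real (floor_index b m) \<le> b * 2 ^ m" "a * 2 ^ m \<le> real (ceil_index a m)"
          unfolding floor_index_def ceil_index_def using ab b by (simp_all add: of_nat_nat)
        ultimately have "real (floor_index b m) \<le> real (ceil_index a m + 4)" by simp
        then have "floor_index b m \<le> ceil_index a m + 4" by (simp only: of_nat_le_iff)
        then show "real (card {p + 1..<q}) \<le> 8" unfolding p_def q_def by simp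
        show "\<rho> ^ Suc m \<le> (b - a) powr \<alpha>" using l1[of 2] by (simp add: m_def)
      qed (use A constants \<rho> in auto)
      finally show ?thesis by simp
    qed
    note cv = increments_summable_convergent[of s u, OF inc su]
    have s_shift: "s = (\<lambda>i. dyadic_sum f g a b (i + (k0 + 2)))"
      unfolding s_def by (intro ext) (simp only: add.commute)
    have conv: "convergent (dyadic_sum f g a b)"
      using cv(1) unfolding s_shift by (simp only: convergent_ignore_initial_segment)
    have "lim s = dyadic_integral f g a b"
      unfolding dyadic_integral_def
    proof (rule limI)
      show "s \<longlonglongrightarrow> lim (dyadic_sum f g a b)"
        unfolding s_shift
        by (rule LIMSEQ_ignore_initial_segment) (use conv in \<open>simp only: convergent_LIMSEQ_iff\<close>)
    qed
    then have "\<bar>dyadic_integral f g a b\<bar> \<le> 16 * A * C * (b - a) powr \<alpha>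
       + (B * (N * (b - a) powr (\<kappa> + \<gamma>)) + 12 * A * C * (b - a) powr \<alpha> * (1 / (1 - \<rho>)))"
      using cv(2) 1 2 by linarith
    also have "\<dots> = ((16 + 12 / (1 - \<rho>)) * C) * (A * (b - a) powr \<alpha>) + N * (B * (b - a) powr (\<kappa> + \<gamma>))"
      by (simp add: algebra_simps)
    also have "\<dots> \<le> integral_const * (A * (b - a) powr \<alpha>) + integral_const * (B * (b - a) powr (\<kappa> + \<gamma>))"
      using A constants \<rho> by (intro add_mono mult_right_mono) (auto simp: integral_const_def)
    finally show ?thesis using conv by (simp add: dyadic_integrable_def distrib_left)
  qed
  then show "dyadic_integrable f g a b"
    "\<bar>dyadic_integral f g a b\<bar> \<le> integral_const * (A * (b - a) powr \<alpha> + B * (b - a) powr (\<kappa> + \<gamma>))"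
    by auto
qed

text \<open>
  At each level the ranges of indices for \<open>[a, c]\<close> and \<open>[c, b]\<close> leave out at most three indices near \<open>c\<close>, and
  single jumps tend to zero.
\<close>

lemma dyadic_integral_add:
  assumes tame: "tame \<kappa> R a b A B f" and ab: "0 \<le> a" "a \<le> c" "c \<le> b" "b \<le> T"
  shows "dyadic_integral f g a b = dyadic_integral f g a c + dyadic_integral f g c b"
proof (cases "a = c \<or> c = b")
  case True
  then show ?thesis using dyadic_sum_trivial_interval(2)[of c f g] ab T by auto
next
  case False
  then have ac: "a < c" and cb: "c < b" using ab by auto
  have 01: "0 \<le> c" "c \<le> 1" "0 \<le> b" "b \<le> 1" using ab T by auto
  let ?D = "\<lambda>m. dyadic_sum f g a b (Suc m) - (dyadic_sum f g a c (Suc m) + dyadic_sum f g c b (Suc m))"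
  have A: "0 \<le> A" using tameD[OF tame] by auto
  \<comment> \<open>From level \<open>m0\<close> on, both parts of the interval contain a cell.\<close>
  obtain m0 where m0: "2 / min (c - a) (b - c) < 2 ^ m0"
    using real_arch_pow[of 2 "2 / min (c - a) (b - c)"] by auto
  have D: "\<bar>?D m\<bar> \<le> 6 * A * C * \<rho> ^ Suc m" if m: "m \<ge> m0" for m
  proof -
    have "(2::real) ^ m0 \<le> 2 ^ m" using m by simp
    then have "2 / min (c - a) (b - c) < 2 ^ m" using m0 by linarith
    then have mm: "2 < min (c - a) (b - c) * 2 ^ m" using ac cb by (simp add: pos_divide_less_eq mult.commute)
    have "min (c - a) (b - c) * 2 ^ m \<le> (c - a) * 2 ^ m" "min (c - a) (b - c) * 2 ^ m \<le> (b - c) * 2 ^ m"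
      by (intro mult_right_mono; simp)+
    then have "2 < c * 2 ^ m - a * 2 ^ m" "2 < b * 2 ^ m - c * 2 ^ m" using mm by (auto simp: algebra_simps)
    then have ne: "ceil_index a m < floor_index c m" "ceil_index c m < floor_index b m" "floor_index c m \<le> ceil_index c m" "ceil_index c m \<le> floor_index c m + 1"
      using ab 01 floor_index_near_ceil_index[of c m] by (auto intro!: ceil_index_less_floor_index)
    let ?j = "jump f g (Suc m)"
    have "(\<Sum>n = 2 * ceil_index a m + 1..<2 * floor_index b m. ?j n) = (\<Sum>n = 2 * ceil_index a m + 1..<2 * floor_index c m. ?j n)
      + (\<Sum>n = 2 * floor_index c m..<2 * ceil_index c m + 1. ?j n) + (\<Sum>n = 2 * ceil_index c m + 1..<2 * floor_index b m. ?j n)"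
      using ne sum.atLeastLessThan_concat[of "2 * ceil_index a m + 1" "2 * floor_index c m" "2 * ceil_index c m + 1" ?j]
        sum.atLeastLessThan_concat[of "2 * ceil_index a m + 1" "2 * ceil_index c m + 1" "2 * floor_index b m" ?j] by linarith
    then have "?D m = (\<Sum>n = 2 * floor_index c m..<2 * ceil_index c m + 1. ?j n)"
      by (simp add: dyadic_sum_eq[OF 01(1,2)] dyadic_sum_eq[OF 01(3,4)])
    also have "\<bar>\<dots>\<bar> \<le> of_nat (card {2 * floor_index c m..<2 * ceil_index c m + 1}) * (2 * A * C * \<rho> ^ Suc m)"
    proof (rule order_trans[OF sum_abs], rule sum_bounded_above)
      fix n assume n: "n \<in> {2 * floor_index c m..<2 * ceil_index c m + 1}"
      have mem: "dyadic (Suc m) n \<in> {a..b}" "dyadic (Suc m) (n+1) \<in> {a..b}"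
        using n ne 01 by (auto simp del: atLeastAtMost_iff intro!: level_mem)
      show "\<bar>?j n\<bar> \<le> 2 * A * C * \<rho> ^ Suc m"
      proof (rule jump_le)
        show "\<bar>f (dyadic (Suc m) n) \<xi>\<bar> \<le> A" if "\<xi> \<in> {-R..R}" for \<xi>
          using tameD(4)[OF tame mem(1) that] .
      qed (use n ne mem A ab tameD(3)[OF tame dyadic_nonneg] in auto)
    qed
    also have "\<dots> \<le> 3 * (2 * A * C * \<rho> ^ Suc m)"
    proof (rule mult_right_mono)
      show "real (card {2 * floor_index c m..<2 * ceil_index c m + 1}) \<le> 3" using ne by simp
    qed (use A constants \<rho> in simp)
    finally show ?thesis by simp
  qed
  have z: "(\<lambda>m. 6 * A * C * \<rho> ^ Suc m) \<longlonglongrightarrow> 0"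
    by (intro tendsto_mult_right_zero LIMSEQ_Suc LIMSEQ_power_zero) (use \<rho> in auto)
  have D0: "?D \<longlonglongrightarrow> 0"
    by (rule Lim_null_comparison[OF _ z]) (use D in \<open>auto simp: eventually_sequentially\<close>)
  have int: "dyadic_integrable f g a b" "dyadic_integrable f g a c" "dyadic_integrable f g c b"
    using ab by (auto intro: dyadic_integral_exists_le tame_mono[OF tame])
  have "?D \<longlonglongrightarrow> dyadic_integral f g a b - (dyadic_integral f g a c + dyadic_integral f g c b)"
    using int[unfolded dyadic_integrable_def convergent_LIMSEQ_iff] unfolding dyadic_integral_def
    by (intro tendsto_diff tendsto_add LIMSEQ_Suc)
  then show ?thesis using LIMSEQ_unique[OF D0] by fastforce
qed

end

section \<open>Functions that are Hoelder on an interval\<close>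

definition holder_on :: "real \<Rightarrow> real \<Rightarrow> real \<Rightarrow> real \<Rightarrow> (real \<Rightarrow> 'e::real_normed_vector) \<Rightarrow> bool" where
  "holder_on \<beta> a b M y \<longleftrightarrow> (\<forall>s\<in>{a..b}. \<forall>t\<in>{a..b}. norm (y s - y t) \<le> M * \<bar>s - t\<bar> powr \<beta>)"

lemma holder_onD: "holder_on \<beta> a b M y \<Longrightarrow> s \<in> {a..b} \<Longrightarrow> t \<in> {a..b} \<Longrightarrow> norm (y s - y t) \<le> M * \<bar>s - t\<bar> powr \<beta>"
  by (simp add: holder_on_def)

lemma holder_onI:
  assumes "\<And>s t. a \<le> s \<Longrightarrow> s \<le> t \<Longrightarrow> t \<le> b \<Longrightarrow> norm (y t - y s) \<le> M * (t - s) powr \<beta>"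
  shows "holder_on \<beta> a b M y"
  unfolding holder_on_def
proof (intro ballI)
  fix s t assume "s \<in> {a..b}" "t \<in> {a..b}"
  then show "norm (y s - y t) \<le> M * \<bar>s - t\<bar> powr \<beta>"
    using assms[of s t] assms[of t s] by (cases "s \<le> t") (auto simp: norm_minus_commute)
qed

lemma holder_on_subset: "holder_on \<beta> a b M y \<Longrightarrow> a \<le> a' \<Longrightarrow> b' \<le> b \<Longrightarrow> holder_on \<beta> a' b' M y"
  by (auto simp: holder_on_def)

lemma holder_on_mono: "holder_on \<beta> a b M y \<Longrightarrow> M \<le> M' \<Longrightarrow> holder_on \<beta> a b M' y"
  unfolding holder_on_def by (meson mult_right_mono order_trans powr_ge_zero)

lemma holder_on_cong: "(\<And>t. t \<in> {a..b} \<Longrightarrow> y t = z t) \<Longrightarrow> holder_on \<beta> a b M y \<longleftrightarrow> holder_on \<beta> a b M z"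
  by (auto simp: holder_on_def)

lemma holder_on_diff:
  assumes "holder_on \<beta> a b M y" "holder_on \<beta> a b M' z"
  shows "holder_on \<beta> a b (M + M') (\<lambda>t. y t - z t)"
  unfolding holder_on_def
proof (intro ballI)
  fix s t assume st: "s \<in> {a..b}" "t \<in> {a..b}"
  have "norm (y s - z s - (y t - z t)) \<le> norm (y s - y t) + norm (z s - z t)"
    using norm_triangle_ineq4[of "y s - y t" "z s - z t"] by (simp add: algebra_simps)
  then show "norm (y s - z s - (y t - z t)) \<le> (M + M') * \<bar>s - t\<bar> powr \<beta>"
    using holder_onD[OF assms(1) st] holder_onD[OF assms(2) st] by (simp add: distrib_right)
qed

text \<open>
  Letting the constant vary with \<open>n\<close> serves two purposes: an estimate that improves itself can be
  iterated to its fixed point, and Picard iterates can be compared with their limit in Hoelder norm.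
\<close>

lemma holder_on_LIMSEQ:
  assumes h: "\<And>n. holder_on \<beta> a b (M n) (y n)" and M: "M \<longlonglongrightarrow> M'"
    and y: "\<And>t. t \<in> {a..b} \<Longrightarrow> (\<lambda>n. y n t) \<longlonglongrightarrow> y' t"
  shows "holder_on \<beta> a b M' y'"
  unfolding holder_on_def
proof (intro ballI)
  fix s t assume st: "s \<in> {a..b}" "t \<in> {a..b}"
  show "norm (y' s - y' t) \<le> M' * \<bar>s - t\<bar> powr \<beta>"
  proof (rule LIMSEQ_le)
    show "(\<lambda>n. norm (y n s - y n t)) \<longlonglongrightarrow> norm (y' s - y' t)" using st by (intro tendsto_intros y)
    show "(\<lambda>n. M n * \<bar>s - t\<bar> powr \<beta>) \<longlonglongrightarrow> M' * \<bar>s - t\<bar> powr \<beta>" by (intro tendsto_intros M)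
  qed (use holder_onD[OF h st] in auto)
qed

lemma holder_on_bound:
  assumes "holder_on \<beta> a b M y" "t \<in> {a..b}" "b - a \<le> 1" "0 \<le> M" "0 \<le> \<beta>"
  shows "norm (y t) \<le> norm (y a) + M"
proof -
  have "norm (y t - y a) \<le> M * \<bar>t - a\<bar> powr \<beta>" using assms by (intro holder_onD[OF assms(1)]) auto
  also have "\<dots> \<le> M * 1" using assms by (intro mult_left_mono powr_le1) auto
  finally show ?thesis using norm_triangle_sub[of "y t" "y a"] by simp
qed

lemma holder_on_join:
  assumes y: "holder_on \<beta> a c M y" and z: "holder_on \<beta> c b M' y"
    and M: "0 \<le> M" "0 \<le> M'" "0 \<le> \<beta>" "a \<le> c" "c \<le> b"
  shows "holder_on \<beta> a b (M + M') y"
proof (rule holder_onI)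
  fix s t assume st: "a \<le> s" "s \<le> t" "t \<le> b"
  consider "t \<le> c" | "c \<le> s" | "s \<le> c" "c \<le> t" by linarith
  then show "norm (y t - y s) \<le> (M + M') * (t - s) powr \<beta>"
  proof cases
    case 1
    then have "norm (y t - y s) \<le> M * (t - s) powr \<beta>" using holder_onD[OF y, of t s] st by auto
    also have "\<dots> \<le> (M + M') * (t - s) powr \<beta>" using M by (intro mult_right_mono) auto
    finally show ?thesis .
  next
    case 2
    then have "norm (y t - y s) \<le> M' * (t - s) powr \<beta>" using holder_onD[OF z, of t s] st by auto
    also have "\<dots> \<le> (M + M') * (t - s) powr \<beta>" using M by (intro mult_right_mono) auto
    finally show ?thesis .
  next
    case 3
    have "norm (y t - y s) \<le> norm (y c - y s) + norm (y t - y c)"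
      using norm_triangle_ineq[of "y c - y s" "y t - y c"] by simp
    also have "\<dots> \<le> M * (c - s) powr \<beta> + M' * (t - c) powr \<beta>"
      using holder_onD[OF y, of c s] holder_onD[OF z, of t c] st 3 by auto
    also have "\<dots> \<le> M * (t - s) powr \<beta> + M' * (t - s) powr \<beta>"
      using M st 3 by (intro add_mono mult_left_mono powr_mono2) auto
    finally show ?thesis by (simp add: distrib_right)
  qed
qed

section \<open>Integral equations whose operator contracts over short times\<close>

text \<open>
  \<open>J y s t\<close> stands for the integral of a coefficient along \<open>y\<close> over \<open>[s, t]\<close>. In \<open>growth\<close> the Hoelder
  constant \<open>M\<close> of \<open>y\<close> enters with a small factor only, and the size of \<open>y\<close> linearly; in \<open>lipschitz\<close> the constant
  may depend on the size of the paths, but the paths have to agree at the left end point.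
\<close>

locale holder_volterra =
  fixes J :: "(real \<Rightarrow> 'e::banach) \<Rightarrow> real \<Rightarrow> real \<Rightarrow> 'e" and \<beta> \<epsilon> T K :: real and \<Lambda> :: "real \<Rightarrow> real \<Rightarrow> real"
  assumes pos: "0 < \<beta>" "0 < \<epsilon>" "0 \<le> K" "\<And>Q M. 0 \<le> \<Lambda> Q M" and T: "0 \<le> T" "T \<le> 1"
    and growth: "\<And>y a b M s t. \<lbrakk>holder_on \<beta> a b M y; 0 \<le> M; 0 \<le> a; a \<le> s; s \<le> t; t \<le> b; b \<le> T\<rbrakk> \<Longrightarrow>
      norm (J y s t) \<le> K * (1 + norm (y a) + (b - a) powr \<epsilon> * (1 + M)) * (t - s) powr \<beta>"
    and lipschitz: "\<And>y z a b M Q d s t. \<lbrakk>holder_on \<beta> a b M y; holder_on \<beta> a b M z; 0 \<le> M;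
        \<And>u. u \<in> {a..b} \<Longrightarrow> norm (y u) \<le> Q; \<And>u. u \<in> {a..b} \<Longrightarrow> norm (z u) \<le> Q; y a = z a;
        holder_on \<beta> a b d (\<lambda>u. z u - y u); 0 \<le> d; 0 \<le> a; a \<le> s; s \<le> t; t \<le> b; b \<le> T\<rbrakk> \<Longrightarrow>
      norm (J z s t - J y s t) \<le> \<Lambda> Q M * (b - a) powr \<epsilon> * d * (t - s) powr \<beta>"
    and additive: "\<And>y M s r t. \<lbrakk>holder_on \<beta> s t M y; 0 \<le> s; s \<le> r; r \<le> t; t \<le> T\<rbrakk> \<Longrightarrow>
      J y s t = J y s r + J y r t"
    and local: "\<And>y z s t. \<lbrakk>0 \<le> s; s \<le> t; t \<le> T; \<And>u. u \<in> {s..t} \<Longrightarrow> y u = z u\<rbrakk> \<Longrightarrow> J y s t = J z s t"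
begin

definition solves :: "'e \<Rightarrow> real \<Rightarrow> real \<Rightarrow> (real \<Rightarrow> 'e) \<Rightarrow> bool" where
  "solves \<eta> a b y \<longleftrightarrow> (\<exists>M\<ge>0. holder_on \<beta> a b M y) \<and> (\<forall>t\<in>{a..b}. y t = \<eta> + J y a t)"

lemma J_trivial: "0 \<le> s \<Longrightarrow> s \<le> T \<Longrightarrow> J y s s = 0"
  using additive[of s s 0 y s] by (simp add: holder_on_def)

lemma increment:
  assumes "solves \<eta> a b y" "0 \<le> a" "b \<le> T" "a \<le> s" "s \<le> t" "t \<le> b"
  shows "y t - y s = J y s t"
proof -
  obtain M where M: "holder_on \<beta> a b M y" using assms(1) by (auto simp: solves_def)
  have "holder_on \<beta> a t M y" using M assms by (auto intro: holder_on_subset)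
  then have "J y a t = J y a s + J y s t" using assms by (intro additive) auto
  moreover have "y t = \<eta> + J y a t" "y s = \<eta> + J y a s" using assms by (auto simp: solves_def)
  ultimately show ?thesis by simp
qed

lemma solves_initial: "solves \<eta> a b y \<Longrightarrow> 0 \<le> a \<Longrightarrow> a \<le> b \<Longrightarrow> b \<le> T \<Longrightarrow> y a = \<eta>"
  by (auto simp: solves_def J_trivial)

lemma solves_restrict:
  assumes "solves \<eta> a b y" "0 \<le> a" "b \<le> T" "a \<le> c" "c \<le> d" "d \<le> b"
  shows "solves (y c) c d y"
proof -
  obtain M where M: "M \<ge> 0" "holder_on \<beta> a b M y" using assms(1) by (auto simp: solves_def)
  then have "holder_on \<beta> c d M y" using assms by (auto intro: holder_on_subset)
  moreover have "y t = y c + J y c t" if "t \<in> {c..d}" for t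
    using increment[OF assms(1-3), of c t] that assms by (auto simp: algebra_simps)
  ultimately show ?thesis using M(1) unfolding solves_def by blast
qed

text \<open>
  The fixed point of \<open>M \<mapsto> K * (1 + Q) + (1 + M) / 2\<close>, which is what \<open>growth\<close> yields for the Hoelder constant of the integral
  on an interval short enough that \<open>K * (b - a) powr \<epsilon> \<le> 1 / 2\<close>. A path with this constant is mapped to a path with this
  constant, and a solution with any finite constant has this one.
\<close>

definition M_bound :: "real \<Rightarrow> real" where "M_bound Q = 2 * K * (1 + Q) + 1"

lemma M_bound_nonneg: "0 \<le> Q \<Longrightarrow> 0 \<le> M_bound Q" using pos by (simp add: M_bound_def)

lemma growth_short:
  assumes short: "K * (b - a) powr \<epsilon> \<le> 1 / 2" and M: "0 \<le> M" "holder_on \<beta> a b M y"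
    and Q: "norm (y a) \<le> Q" and st: "0 \<le> a" "a \<le> s" "s \<le> t" "t \<le> b" "b \<le> T"
  shows "norm (J y s t) \<le> (M_bound Q + (M - M_bound Q) / 2) * (t - s) powr \<beta>"
proof -
  have "norm (J y s t) \<le> K * (1 + norm (y a) + (b - a) powr \<epsilon> * (1 + M)) * (t - s) powr \<beta>"
    by (rule growth) (use assms in auto)
  also have "\<dots> \<le> (M_bound Q + (M - M_bound Q) / 2) * (t - s) powr \<beta>"
  proof (rule mult_right_mono)
    have "K * (1 + norm (y a) + (b - a) powr \<epsilon> * (1 + M))
       = K * (1 + norm (y a)) + (K * (b - a) powr \<epsilon>) * (1 + M)" by (simp add: algebra_simps)
    also have "\<dots> \<le> K * (1 + Q) + (1 / 2) * (1 + M)"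
      using pos Q M short by (intro add_mono mult_left_mono mult_right_mono) auto
    also have "\<dots> = M_bound Q + (M - M_bound Q) / 2" by (simp add: M_bound_def field_simps)
    finally show "K * (1 + norm (y a) + (b - a) powr \<epsilon> * (1 + M)) \<le> M_bound Q + (M - M_bound Q) / 2" .
  qed simp
  finally show ?thesis .
qed

lemma halving_tendsto: "(\<lambda>n. c + (x::real) / 2 ^ n) \<longlonglongrightarrow> c"
proof -
  have "(\<lambda>n. c + x * (1 / 2) ^ n) \<longlonglongrightarrow> c + x * 0"
    by (intro tendsto_intros LIMSEQ_power_zero) auto
  then show ?thesis by (simp add: power_divide)
qed

text \<open>
  If \<open>M\<close> is a Hoelder constant of the solution, then \<open>growth_short\<close> shows that the distance of \<open>M\<close> to
  \<open>M_bound Q\<close> can be halved. Iteration needs that some finite constant exists, which is part of the notion of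
  a solution.
\<close>

lemma a_priori_holder:
  assumes sol: "solves \<eta> a b y" and ab: "0 \<le> a" "a \<le> b" "b \<le> T"
    and short: "K * (b - a) powr \<epsilon> \<le> 1 / 2" and Q: "norm \<eta> \<le> Q"
  shows "holder_on \<beta> a b (M_bound Q) y"
proof -
  obtain M0 where M0: "M0 \<ge> 0" "holder_on \<beta> a b M0 y" using sol by (auto simp: solves_def)
  have Q0: "0 \<le> Q" using Q norm_ge_zero order_trans by blast
  define M where "M = max M0 (M_bound Q)"
  have M: "M \<ge> M_bound Q" "holder_on \<beta> a b M y"
    using M0(2) by (auto simp: M_def intro: holder_on_mono)
  have ya: "norm (y a) \<le> Q" using solves_initial[OF sol ab] Q by simp
  have "holder_on \<beta> a b (M_bound Q + (M - M_bound Q) / 2 ^ n) y" for n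
  proof (induction n)
    case 0 then show ?case using M by simp
  next
    case (Suc n)
    show ?case
    proof (rule holder_onI)
      fix s t assume st: "a \<le> s" "s \<le> t" "t \<le> b"
      have "norm (J y s t) \<le> (M_bound Q + (M_bound Q + (M - M_bound Q) / 2 ^ n - M_bound Q) / 2) * (t - s) powr \<beta>"
        using M_bound_nonneg[OF Q0] M(1) by (intro growth_short[OF short _ Suc ya]) (use st ab in auto)
      then show "norm (y t - y s) \<le> (M_bound Q + (M - M_bound Q) / 2 ^ Suc n) * (t - s) powr \<beta>"
        using increment[OF sol ab(1,3) st] by (simp add: mult.commute)
    qed
  qed
  then show ?thesis
    by (rule holder_on_LIMSEQ[where y = "\<lambda>_. y", OF _ halving_tendsto]) simp
qed

lemma a_priori_step:
  assumes sol: "solves \<eta> a b y" and ab: "0 \<le> a" "a \<le> b" "b \<le> T"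
    and short: "K * (b - a) powr \<epsilon> \<le> 1 / 2" and t: "t \<in> {a..b}"
  shows "1 + norm (y t) \<le> (2 * K + 2) * (1 + norm \<eta>)"
proof -
  have "norm (y t) \<le> norm (y a) + M_bound (norm \<eta>)"
    using t ab T pos
    by (intro holder_on_bound[OF a_priori_holder[OF sol ab short order_refl]]) (auto intro: M_bound_nonneg)
  moreover have "(2 * K + 2) * (1 + norm \<eta>) = 1 + norm \<eta> + M_bound (norm \<eta>) + norm \<eta>"
    by (simp add: M_bound_def algebra_simps)
  moreover have "norm (y a) = norm \<eta>" using solves_initial[OF sol ab] by simp
  ultimately show ?thesis using norm_ge_zero[of \<eta>] by linarith
qed

lemma short_step_exists:
  assumes "0 \<le> c" shows "\<exists>\<delta>>0. c * \<delta> powr \<epsilon> \<le> 1 / 2"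
proof -
  \<comment> \<open>The summand 1 keeps the witness meaningful for \<open>c = 0\<close>.\<close>
  define \<delta> where "\<delta> = (1 / (2 * (c + 1))) powr (1 / \<epsilon>)"
  have "\<delta> powr \<epsilon> = 1 / (2 * (c + 1))" using pos assms by (simp add: \<delta>_def powr_powr)
  moreover have "c * (1 / (2 * (c + 1))) \<le> 1 / 2" using assms by (simp add: field_simps)
  ultimately have "c * \<delta> powr \<epsilon> \<le> 1 / 2" by simp
  moreover have "\<delta> > 0" using assms by (simp add: \<delta>_def)
  ultimately show ?thesis by blast
qed

lemma short_mono:
  assumes "c * \<delta> powr \<epsilon> \<le> 1 / 2" "0 \<le> c" "0 \<le> l" "l \<le> \<delta>"
  shows "c * l powr \<epsilon> \<le> 1 / 2"
proof -
  have "l powr \<epsilon> \<le> \<delta> powr \<epsilon>" using assms pos by (intro powr_mono2) auto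
  then show ?thesis using assms mult_left_mono[of "l powr \<epsilon>" "\<delta> powr \<epsilon>" c] by linarith
qed

text \<open>
  Since the admissible length \<open>\<delta>\<close> depends on \<open>K\<close> only, the number of applications of \<open>a_priori_step\<close> needed to
  cross \<open>[0, T]\<close> is fixed in advance.
\<close>

lemma a_priori_bound:
  "\<exists>Q. \<forall>b y. 0 \<le> b \<and> b \<le> T \<and> solves \<eta> 0 b y \<longrightarrow> (\<forall>t\<in>{0..b}. norm (y t) \<le> Q)"
proof -
  obtain \<delta> where \<delta>: "\<delta> > 0" "K * \<delta> powr \<epsilon> \<le> 1 / 2" using short_step_exists[OF pos(3)] by blast
  obtain N where N: "1 / \<delta> < real N" using reals_Archimedean2 by blast
  have "norm (y t) \<le> (2 * K + 2) ^ N * (1 + norm \<eta>)"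
    if b: "0 \<le> b" "b \<le> T" and sol: "solves \<eta> 0 b y" and t: "t \<in> {0..b}" for b y t
  proof -
    have "\<forall>t\<in>{0..b}. t \<le> real n * \<delta> \<longrightarrow> 1 + norm (y t) \<le> (2 * K + 2) ^ n * (1 + norm \<eta>)" for n
    proof (induction n)
      case 0
      then show ?case using solves_initial[OF sol] b by auto
    next
      case (Suc n)
      show ?case
      proof (intro ballI impI)
        fix t assume t: "t \<in> {0..b}" "t \<le> real (Suc n) * \<delta>"
        define s where "s = min t (real n * \<delta>)"
        have s: "0 \<le> s" "s \<le> t" "t - s \<le> \<delta>" "s \<le> real n * \<delta>"
          using t \<delta> by (auto simp: s_def algebra_simps)
        have "1 + norm (y t) \<le> (2 * K + 2) * (1 + norm (y s))"
        proof (rule a_priori_step[of "y s" s t])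
          show "solves (y s) s t y" using s t b by (intro solves_restrict[OF sol]) auto
          show "K * (t - s) powr \<epsilon> \<le> 1 / 2" using s pos by (intro short_mono[OF \<delta>(2)]) auto
        qed (use s t b in auto)
        also have "\<dots> \<le> (2 * K + 2) * ((2 * K + 2) ^ n * (1 + norm \<eta>))"
          using Suc s t pos by (intro mult_left_mono) auto
        finally show "1 + norm (y t) \<le> (2 * K + 2) ^ Suc n * (1 + norm \<eta>)" by (simp add: mult.assoc)
      qed
    qed
    moreover have "t \<le> real N * \<delta>" using N t b T \<delta> by (auto simp: field_simps)
    ultimately show ?thesis using t by fastforce
  qed
  then show ?thesis by blast
qed

text \<open>
  The contraction, stated for the Hoelder constant of the difference. Paths with constant
  \<open>M_bound Q\<close> that start in the ball of radius \<open>Q\<close> stay in the ball of radius \<open>Q + M_bound Q\<close>, as the interval is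
  not longer than 1.
\<close>

lemma difference_halves:
  assumes y: "holder_on \<beta> a b (M_bound Q) y" and z: "holder_on \<beta> a b (M_bound Q) z"
    and init: "y a = z a" "norm (y a) \<le> Q"
    and d: "holder_on \<beta> a b d (\<lambda>u. z u - y u)" "0 \<le> d"
    and ab: "0 \<le> a" "a \<le> b" "b \<le> T"
    and short: "\<Lambda> (Q + M_bound Q) (M_bound Q) * (b - a) powr \<epsilon> \<le> 1 / 2"
  shows "holder_on \<beta> a b (d / 2) (\<lambda>u. J z a u - J y a u)"
proof (rule holder_onI)
  fix s t assume st: "a \<le> s" "s \<le> t" "t \<le> b"
  have Q0: "0 \<le> Q" using init norm_ge_zero order_trans by blast
  note M0 = M_bound_nonneg[OF Q0]
  have "norm (J z s t - J y s t) \<le> \<Lambda> (Q + M_bound Q) (M_bound Q) * (b - a) powr \<epsilon> * d * (t - s) powr \<beta>"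
  proof (rule lipschitz[OF y z M0 _ _ init(1) d])
    show "norm (y u) \<le> Q + M_bound Q" "norm (z u) \<le> Q + M_bound Q" if "u \<in> {a..b}" for u
      using holder_on_bound[OF y that] holder_on_bound[OF z that] init ab T pos M0 by auto
  qed (use st ab in auto)
  also have "\<dots> \<le> (1 / 2) * d * (t - s) powr \<beta>"
    using short d by (intro mult_right_mono) auto
  finally have "norm (J z s t - J y s t) \<le> d / 2 * (t - s) powr \<beta>" by simp
  moreover have "J z a t = J z a s + J z s t" "J y a t = J y a s + J y s t"
    by (rule additive[OF holder_on_subset[OF z]] additive[OF holder_on_subset[OF y]]; use st ab in simp)+
  ultimately show "norm (J z a t - J y a t - (J z a s - J y a s)) \<le> d / 2 * (t - s) powr \<beta>"
    by (simp add: algebra_simps)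
qed

lemma local_uniqueness:
  assumes sol: "solves \<eta> a b y" "solves \<eta> a b z" and Q: "norm \<eta> \<le> Q"
    and ab: "0 \<le> a" "a \<le> b" "b \<le> T"
    and short: "K * (b - a) powr \<epsilon> \<le> 1 / 2" "\<Lambda> (Q + M_bound Q) (M_bound Q) * (b - a) powr \<epsilon> \<le> 1 / 2"
    and t: "t \<in> {a..b}"
  shows "y t = z t"
proof -
  have y: "holder_on \<beta> a b (M_bound Q) y" and z: "holder_on \<beta> a b (M_bound Q) z"
    using a_priori_holder[OF _ ab short(1) Q] sol by auto
  have init: "y a = \<eta>" "z a = \<eta>" using solves_initial[OF _ ab] sol by auto
  have Q0: "0 \<le> Q" using Q norm_ge_zero order_trans by blast
  have "holder_on \<beta> a b (0 + (M_bound Q + M_bound Q) / 2 ^ n) (\<lambda>u. z u - y u)" for n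
  proof (induction n)
    case 0 then show ?case using holder_on_diff[OF z y] by simp
  next
    case (Suc n)
    have "holder_on \<beta> a b ((0 + (M_bound Q + M_bound Q) / 2 ^ n) / 2) (\<lambda>u. J z a u - J y a u)"
      by (rule difference_halves[OF y z _ _ Suc]) (use init Q ab short(2) M_bound_nonneg[OF Q0] in auto)
    moreover have "z u - y u = J z a u - J y a u" if "u \<in> {a..b}" for u
      using sol that by (auto simp: solves_def)
    ultimately show ?case
      using holder_on_cong[of a b "\<lambda>u. z u - y u" "\<lambda>u. J z a u - J y a u"] by simp
  qed
  then have "holder_on \<beta> a b 0 (\<lambda>u. z u - y u)"
    by (rule holder_on_LIMSEQ[where y = "\<lambda>_ u. z u - y u", OF _ halving_tendsto]) simp
  then show ?thesis using holder_onD[of \<beta> a b 0 "\<lambda>u. z u - y u" t a] t ab init by simp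
qed

text \<open>
  Picard iteration from the constant path. The differences of consecutive iterates have geometrically decreasing
  Hoelder constants and vanish at \<open>a\<close>, so the iterates converge and their integrals converge to the integral of the
  limit.
\<close>

lemma local_existence:
  assumes Q: "norm \<eta> \<le> Q" and ab: "0 \<le> a" "a \<le> b" "b \<le> T"
    and short: "K * (b - a) powr \<epsilon> \<le> 1 / 2" "\<Lambda> (Q + M_bound Q) (M_bound Q) * (b - a) powr \<epsilon> \<le> 1 / 2"
  shows "\<exists>y. solves \<eta> a b y"
proof -
  have Q0: "0 \<le> Q" using Q norm_ge_zero order_trans by blast
  note M0 = M_bound_nonneg[OF Q0]
  let ?M = "M_bound Q"
  define Y where "Y = rec_nat (\<lambda>_. \<eta>) (\<lambda>_ y t. \<eta> + J y a t)"
  have Y0: "Y 0 = (\<lambda>_. \<eta>)" and YS: "Y (Suc n) = (\<lambda>t. \<eta> + J (Y n) a t)" for n by (simp_all add: Y_def)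
  have Ya: "Y n a = \<eta>" for n using J_trivial ab by (cases n) (auto simp: Y0 YS)
  have YM: "holder_on \<beta> a b ?M (Y n)" for n
  proof (induction n)
    case 0 then show ?case using M0 by (simp add: Y0 holder_on_def)
  next
    case (Suc n)
    show ?case
    proof (rule holder_onI)
      fix s t assume st: "a \<le> s" "s \<le> t" "t \<le> b"
      have "norm (J (Y n) s t) \<le> (?M + (?M - ?M) / 2) * (t - s) powr \<beta>"
        using Ya[of n] Q by (intro growth_short[OF short(1) M0 Suc]) (use st ab in auto)
      moreover have "J (Y n) a t = J (Y n) a s + J (Y n) s t"
        by (rule additive[OF holder_on_subset[OF Suc]]) (use st ab in auto)
      ultimately show "norm (Y (Suc n) t - Y (Suc n) s) \<le> ?M * (t - s) powr \<beta>" by (simp add: YS)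
    qed
  qed
  have step: "holder_on \<beta> a b ((?M + ?M) / 2 ^ n) (\<lambda>u. Y (Suc n) u - Y n u)" for n
  proof (induction n)
    case 0 then show ?case using holder_on_diff[OF YM YM] by simp
  next
    case (Suc n)
    have "holder_on \<beta> a b ((?M + ?M) / 2 ^ n / 2) (\<lambda>u. J (Y (Suc n)) a u - J (Y n) a u)"
      by (rule difference_halves[OF YM YM _ _ Suc]) (use Ya Q ab short(2) M0 in auto)
    then show ?case by (simp add: YS mult.commute)
  qed
  \<comment> \<open>The difference of the two constants is the sum of the geometric series between \<open>n\<close> and \<open>n + m\<close>.\<close>
  have tail: "holder_on \<beta> a b (4 * ?M / 2 ^ n - 4 * ?M / 2 ^ (n + m)) (\<lambda>u. Y (n + m) u - Y n u)" for n m
  proof (induction m)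
    case 0 then show ?case by (simp add: holder_on_def)
  next
    case (Suc m)
    show ?case
    proof (rule holder_onI)
      fix s t assume st: "a \<le> s" "s \<le> t" "t \<le> b"
      have "norm (Y (Suc (n+m)) t - Y (n+m) t - (Y (Suc (n+m)) s - Y (n+m) s)) \<le> (?M + ?M) / 2 ^ (n + m) * (t - s) powr \<beta>"
        "norm (Y (n+m) t - Y n t - (Y (n+m) s - Y n s)) \<le> (4 * ?M / 2 ^ n - 4 * ?M / 2 ^ (n + m)) * (t - s) powr \<beta>"
        using holder_onD[OF step[of "n+m"], of t s] holder_onD[OF Suc, of t s] st by auto
      moreover have "norm (Y (n + Suc m) t - Y n t - (Y (n + Suc m) s - Y n s))
        \<le> norm (Y (Suc (n+m)) t - Y (n+m) t - (Y (Suc (n+m)) s - Y (n+m) s)) + norm (Y (n+m) t - Y n t - (Y (n+m) s - Y n s))"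
        using norm_triangle_ineq[of "Y (Suc (n+m)) t - Y (n+m) t - (Y (Suc (n+m)) s - Y (n+m) s)" "Y (n+m) t - Y n t - (Y (n+m) s - Y n s)"]
        by (simp add: algebra_simps)
      moreover have "(?M + ?M) / 2 ^ (n + m) * (t - s) powr \<beta> + (4 * ?M / 2 ^ n - 4 * ?M / 2 ^ (n + m)) * (t - s) powr \<beta>
        = (4 * ?M / 2 ^ n - 4 * ?M / 2 ^ (n + Suc m)) * (t - s) powr \<beta>"
        by (simp add: field_simps)
      ultimately show "norm (Y (n + Suc m) t - Y n t - (Y (n + Suc m) s - Y n s)) \<le> (4 * ?M / 2 ^ n - 4 * ?M / 2 ^ (n + Suc m)) * (t - s) powr \<beta>"
        by linarith
    qed
  qed
  have tail': "holder_on \<beta> a b (4 * ?M / 2 ^ n) (\<lambda>u. Y (n + m) u - Y n u)" for n m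
    by (rule holder_on_mono[OF tail]) (use M0 in simp)
  have "convergent (\<lambda>n. Y n t)" if t: "t \<in> {a..b}" for t
  proof (rule Cauchy_convergent, rule metric_CauchyI)
    fix e :: real assume e: "e > 0"
    obtain n where n: "4 * ?M / 2 ^ n < e / 2"
    proof -
      have "\<forall>\<^sub>F n in sequentially. 0 + 4 * ?M / 2 ^ n < e / 2"
        using halving_tendsto[of 0 "4 * ?M"] e by (intro order_tendstoD(2)) auto
      then show ?thesis using that by (auto simp: eventually_sequentially)
    qed
    have "dist (Y i t) (Y n t) < e / 2" if "i \<ge> n" for i
    proof -
      define m where "m = i - n"
      have m: "i = n + m" using that by (simp add: m_def)
      have "norm (Y i t - Y n t) \<le> norm (Y i a - Y n a) + 4 * ?M / 2 ^ n"
        unfolding m using t ab T pos M0 by (intro holder_on_bound[OF tail']) auto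
      moreover have "norm (Y i a - Y n a) = 0" by (simp add: Ya)
      ultimately show ?thesis using n unfolding dist_norm by linarith
    qed
    then show "\<exists>n. \<forall>i\<ge>n. \<forall>j\<ge>n. dist (Y i t) (Y j t) < e"
      by (intro exI[of _ n] allI impI) (rule dist_triangle_half_l; simp)
  qed
  then obtain y where y: "\<And>t. t \<in> {a..b} \<Longrightarrow> (\<lambda>n. Y n t) \<longlonglongrightarrow> y t"
    unfolding convergent_def by metis
  have hy: "holder_on \<beta> a b ?M y" by (rule holder_on_LIMSEQ[OF YM tendsto_const y])
  have hd: "holder_on \<beta> a b (4 * ?M / 2 ^ n) (\<lambda>u. y u - Y n u)" for n
  proof (rule holder_on_LIMSEQ[where y = "\<lambda>m u. Y (n + m) u - Y n u"])
    show "holder_on \<beta> a b (4 * ?M / 2 ^ n) (\<lambda>u. Y (n + m) u - Y n u)" for m by (rule tail')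
    show "(\<lambda>m. Y (n + m) t - Y n t) \<longlonglongrightarrow> y t - Y n t" if "t \<in> {a..b}" for t
      using LIMSEQ_ignore_initial_segment[OF y[OF that], of n] by (intro tendsto_intros) (simp add: add.commute)
  qed simp
  have ya: "y a = \<eta>" using LIMSEQ_unique[OF y[of a]] Ya ab by auto
  have "y t = \<eta> + J y a t" if t: "t \<in> {a..b}" for t
  proof (rule LIMSEQ_unique)
    show "(\<lambda>n. Y (Suc n) t) \<longlonglongrightarrow> y t" by (rule LIMSEQ_Suc[OF y[OF t]])
    have "(\<lambda>n. Y (Suc n) t - (\<eta> + J y a t)) \<longlonglongrightarrow> 0"
    proof (rule Lim_null_comparison[OF always_eventually])
      show "(\<lambda>n. 0 + (2 * ?M) / 2 ^ n) \<longlonglongrightarrow> 0" by (rule halving_tendsto)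
      show "\<forall>n. norm (Y (Suc n) t - (\<eta> + J y a t)) \<le> 0 + (2 * ?M) / 2 ^ n"
      proof
        fix n
        have h: "holder_on \<beta> a b (4 * ?M / 2 ^ n / 2) (\<lambda>u. J y a u - J (Y n) a u)"
          by (rule difference_halves[OF YM hy _ _ hd]) (use Ya ya Q ab short(2) M0 in auto)
        have "norm (J y a t - J (Y n) a t) \<le> norm (J y a a - J (Y n) a a) + 4 * ?M / 2 ^ n / 2"
          using t ab T pos M0 by (intro holder_on_bound[OF h]) auto
        then show "norm (Y (Suc n) t - (\<eta> + J y a t)) \<le> 0 + (2 * ?M) / 2 ^ n"
          using J_trivial ab by (simp add: YS norm_minus_commute)
      qed
    qed
    then show "(\<lambda>n. Y (Suc n) t) \<longlonglongrightarrow> \<eta> + J y a t" by (simp add: LIM_zero_iff)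
  qed
  then have "solves \<eta> a b y" using hy M0 by (auto simp: solves_def)
  then show ?thesis by blast
qed

theorem exists_unique_solution:
  "\<exists>y. solves \<eta> 0 T y \<and> (\<forall>z. solves \<eta> 0 T z \<longrightarrow> (\<forall>t\<in>{0..T}. z t = y t))"
proof -
  obtain Q where Q: "\<And>b y t. 0 \<le> b \<Longrightarrow> b \<le> T \<Longrightarrow> solves \<eta> 0 b y \<Longrightarrow> t \<in> {0..b} \<Longrightarrow> norm (y t) \<le> Q"
    using a_priori_bound[of \<eta>] by blast
  define \<Lambda>' where "\<Lambda>' = \<Lambda> (Q + M_bound Q) (M_bound Q)"
  obtain \<delta> where \<delta>: "\<delta> > 0" "(K + \<Lambda>') * \<delta> powr \<epsilon> \<le> 1 / 2"
    using short_step_exists[of "K + \<Lambda>'"] pos by (auto simp: \<Lambda>'_def)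
  have short: "K * l powr \<epsilon> \<le> 1 / 2" "\<Lambda>' * l powr \<epsilon> \<le> 1 / 2" if "0 \<le> l" "l \<le> \<delta>" for l
  proof -
    have "(K + \<Lambda>') * l powr \<epsilon> \<le> 1 / 2"
      using that pos by (intro short_mono[OF \<delta>(2)]) (auto simp: \<Lambda>'_def)
    moreover have "0 \<le> K * l powr \<epsilon>" "0 \<le> \<Lambda>' * l powr \<epsilon>" using pos by (simp_all add: \<Lambda>'_def)
    ultimately show "K * l powr \<epsilon> \<le> 1 / 2" "\<Lambda>' * l powr \<epsilon> \<le> 1 / 2" by (auto simp: distrib_right)
  qed
  define \<tau> where "\<tau> n = min (real n * \<delta>) T" for n
  have \<tau>: "0 \<le> \<tau> n" "\<tau> n \<le> T" "\<tau> n \<le> \<tau> (Suc n)" "\<tau> (Suc n) - \<tau> n \<le> \<delta>" for n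
    using \<delta> T by (auto simp: \<tau>_def algebra_simps)
  have "\<exists>y. solves \<eta> 0 (\<tau> n) y" for n
  proof (induction n)
    case 0
    have "solves \<eta> 0 0 (\<lambda>_. \<eta>)" using J_trivial T by (auto simp: solves_def holder_on_def)
    then show ?case using T by (auto simp: \<tau>_def)
  next
    case (Suc n)
    then obtain y where y: "solves \<eta> 0 (\<tau> n) y" by blast
    have yQ: "norm (y (\<tau> n)) \<le> Q" using Q[OF _ _ y] \<tau> by auto
    obtain z where z: "solves (y (\<tau> n)) (\<tau> n) (\<tau> (Suc n)) z"
      using local_existence[OF yQ, of "\<tau> n" "\<tau> (Suc n)"] \<tau> short[of "\<tau> (Suc n) - \<tau> n"] by (auto simp: \<Lambda>'_def)
    have zi: "z (\<tau> n) = y (\<tau> n)" using solves_initial[OF z] \<tau> by blast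
    define w where "w t = (if t \<le> \<tau> n then y t else z t)" for t
    have wy: "w t = y t" if "t \<in> {0..\<tau> n}" for t using that by (simp add: w_def)
    have wz: "w t = z t" if "t \<in> {\<tau> n..\<tau> (Suc n)}" for t using that zi by (auto simp: w_def)
    obtain M1 where M1: "M1 \<ge> 0" "holder_on \<beta> 0 (\<tau> n) M1 y" using y by (auto simp: solves_def)
    obtain M2 where M2: "M2 \<ge> 0" "holder_on \<beta> (\<tau> n) (\<tau> (Suc n)) M2 z" using z by (auto simp: solves_def)
    have hw: "holder_on \<beta> 0 (\<tau> (Suc n)) (M1 + M2) w"
    proof (rule holder_on_join)
      show "holder_on \<beta> 0 (\<tau> n) M1 w" using M1 holder_on_cong[of 0 "\<tau> n" w y] wy by blast
      show "holder_on \<beta> (\<tau> n) (\<tau> (Suc n)) M2 w" using M2 holder_on_cong[of "\<tau> n" "\<tau> (Suc n)" w z] wz by blast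
    qed (use M1 M2 pos \<tau> in auto)
    have "w t = \<eta> + J w 0 t" if t: "t \<in> {0..\<tau> (Suc n)}" for t
    proof (cases "t \<le> \<tau> n")
      case True
      then have "J w 0 t = J y 0 t" using t \<tau>[of n] by (intro local) (auto simp: w_def)
      then show ?thesis using y True t by (auto simp: w_def solves_def)
    next
      case False
      have "J w 0 t = J w 0 (\<tau> n) + J w (\<tau> n) t"
        by (rule additive[OF holder_on_subset[OF hw]]) (use False t \<tau>[of n] \<tau>(2)[of "Suc n"] in auto)
      also have "J w 0 (\<tau> n) = J y 0 (\<tau> n)" using \<tau>[of n] wy by (intro local) auto
      also have "J w (\<tau> n) t = J z (\<tau> n) t" using \<tau>[of n] \<tau>(2)[of "Suc n"] wz t False by (intro local) auto
      also have "J y 0 (\<tau> n) = y (\<tau> n) - \<eta>" using y \<tau>[of n] by (auto simp: solves_def algebra_simps)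
      also have "J z (\<tau> n) t = z t - y (\<tau> n)" using z t False by (auto simp: solves_def algebra_simps)
      finally have "J w 0 t = z t - \<eta>" by simp
      moreover have "w t = z t" using False by (simp add: w_def)
      ultimately show ?thesis by simp
    qed
    moreover have "0 \<le> M1 + M2" using M1 M2 by simp
    ultimately have "solves \<eta> 0 (\<tau> (Suc n)) w" using hw unfolding solves_def by blast
    then show ?case by blast
  qed
  moreover obtain N where "T / \<delta> < real N" using reals_Archimedean2 by blast
  then have \<tau>N: "\<tau> N = T" using \<delta> by (simp add: \<tau>_def field_simps)
  ultimately obtain y where y: "solves \<eta> 0 T y" by metis
  have "z t = y t" if z: "solves \<eta> 0 T z" and t: "t \<in> {0..T}" for z t
  proof -
    have "\<forall>t\<in>{0..\<tau> n}. z t = y t" for n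
    proof (induction n)
      case 0
      then show ?case using solves_initial[OF y] solves_initial[OF z] T by (auto simp: \<tau>_def)
    next
      case (Suc n)
      have eq: "z (\<tau> n) = y (\<tau> n)" using Suc \<tau>[of n] by auto
      have "z t = y t" if t: "t \<in> {\<tau> n..\<tau> (Suc n)}" for t
      proof (rule local_uniqueness[where Q = Q])
        show "solves (y (\<tau> n)) (\<tau> n) (\<tau> (Suc n)) y"
          using \<tau>[of n] \<tau>(2)[of "Suc n"] by (intro solves_restrict[OF y]) auto
        have "solves (z (\<tau> n)) (\<tau> n) (\<tau> (Suc n)) z"
          using \<tau>[of n] \<tau>(2)[of "Suc n"] by (intro solves_restrict[OF z]) auto
        then show "solves (y (\<tau> n)) (\<tau> n) (\<tau> (Suc n)) z" using eq by simp
        show "norm (y (\<tau> n)) \<le> Q" using Q[OF T(1) _ y] \<tau>[of n] by auto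
      qed (use t \<tau>[of n] \<tau>(2)[of "Suc n"] short[of "\<tau> (Suc n) - \<tau> n"] in \<open>auto simp: \<Lambda>'_def\<close>)
      then show ?case using Suc by (metis atLeastAtMost_iff linear)
    qed
    then show ?thesis using t \<tau>N by metis
  qed
  then show ?thesis using y by blast
qed

end

section \<open>Coefficients: growth, Hoelder bounds and the gradient\<close>

text \<open>
  The increment is telescoped over the coordinates: \<open>part S\<close> keeps the entries of the increment with
  index in \<open>S\<close>, and adding one index to \<open>S\<close> changes a single variable, for which the mean value bound applies.
\<close>

lemma has_derivative_of_continuous_partials:
  fixes f :: "real^'m \<Rightarrow> real" and G :: "real^'m \<Rightarrow> real^'m"
  assumes partial: "\<And>y k. ((\<lambda>s. f (y + s *\<^sub>R axis k 1)) has_real_derivative G y $ k) (at 0)"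
    and cont: "continuous_on UNIV G"
  shows "(f has_derivative (\<lambda>h. G y \<bullet> h)) (at y)"
proof -
  have partial': "((\<lambda>s. f (p + s *\<^sub>R axis k 1)) has_real_derivative G (p + s *\<^sub>R axis k 1) $ k) (at s)" for p k s
  proof -
    have "((\<lambda>r. f ((p + s *\<^sub>R axis k 1) + r *\<^sub>R axis k 1)) has_real_derivative G (p + s *\<^sub>R axis k 1) $ k) (at (s - s))"
      using partial[of "p + s *\<^sub>R axis k 1" k] by simp
    moreover have "((\<lambda>r. r - s) has_real_derivative 1) (at s)" by (auto intro!: derivative_eq_intros)
    ultimately have "((\<lambda>r. f ((p + s *\<^sub>R axis k 1) + (r - s) *\<^sub>R axis k 1)) has_real_derivative G (p + s *\<^sub>R axis k 1) $ k) (at s)"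
      using DERIV_chain'[of "\<lambda>r. r - s" 1 s UNIV] by fastforce
    then show ?thesis by (simp add: algebra_simps)
  qed
  let ?n = "real CARD('m)"
  show ?thesis
    unfolding has_derivative_at_alt
  proof (intro conjI allI impI)
    show "bounded_linear (\<lambda>h. G y \<bullet> h)" by (rule bounded_linear_inner_right)
    fix e :: real assume e: "e > 0"
    then have "e / ?n > 0" by simp
    then obtain \<delta> where \<delta>: "\<delta> > 0" "\<And>z. dist z y < \<delta> \<Longrightarrow> dist (G z) (G y) < e / ?n"
      using cont[unfolded continuous_on_iff] by (metis UNIV_I)
    have "norm (f z - f y - G y \<bullet> (z - y)) \<le> e * norm (z - y)" if z: "norm (z - y) < \<delta>" for z
    proof -
      define h where "h = z - y"
      define part where "part S = (\<chi> k. if k \<in> S then h $ k else 0)" for S :: "'m set"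
      have "\<bar>f (y + part S) - f y - (\<Sum>k\<in>S. G y $ k * h $ k)\<bar> \<le> real (card S) * (e / ?n * norm h)" for S
      proof (induction S rule: finite_induct[OF finite])
        case 1
        have "part {} = 0" by (simp add: part_def vec_eq_iff)
        then show ?case by simp
      next
        case (2 k S)
        have ins: "part (insert k S) = part S + h $ k *\<^sub>R axis k 1"
          using 2(2) by (auto simp: part_def vec_eq_iff axis_def)
        let ?\<phi> = "\<lambda>s. f ((y + part S) + s *\<^sub>R axis k 1) - s * G y $ k"
        have "norm (?\<phi> (h $ k) - ?\<phi> 0) \<le> e / ?n * norm (h $ k - 0)"
        proof (rule field_differentiable_bound[of "closed_segment 0 (h $ k)" ?\<phi>
              "\<lambda>s. G (y + part S + s *\<^sub>R axis k 1) $ k - G y $ k"])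
          fix s assume s: "s \<in> closed_segment 0 (h $ k)"
          show "(?\<phi> has_field_derivative G (y + part S + s *\<^sub>R axis k 1) $ k - G y $ k) (at s within closed_segment 0 (h $ k))"
            by (rule has_field_derivative_at_within) (auto intro!: derivative_eq_intros partial')
          have "\<bar>s\<bar> \<le> \<bar>h $ k\<bar>" using s by (auto simp: closed_segment_eq_real_ivl split: if_splits)
          then have "norm (part S + s *\<^sub>R axis k 1) \<le> norm h"
            using 2(2) by (intro norm_le_componentwise_cart) (auto simp: part_def axis_def)
          then have "dist (y + part S + s *\<^sub>R axis k 1) y < \<delta>"
            using z by (simp add: dist_norm h_def add.assoc)
          then have "norm (G (y + part S + s *\<^sub>R axis k 1) - G y) < e / ?n"
            using \<delta>(2) by (simp add: dist_norm)
          then show "norm (G (y + part S + s *\<^sub>R axis k 1) $ k - G y $ k) \<le> e / ?n"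
            using component_le_norm_cart[of "G (y + part S + s *\<^sub>R axis k 1) - G y" k] by simp
        qed auto
        also have "\<dots> \<le> e / ?n * norm h"
          using e component_le_norm_cart[of h k] by (intro mult_left_mono) auto
        finally have "\<bar>f (y + part (insert k S)) - f (y + part S) - G y $ k * h $ k\<bar> \<le> e / ?n * norm h"
          by (simp add: ins algebra_simps)
        moreover have "(\<Sum>i\<in>insert k S. G y $ i * h $ i) = G y $ k * h $ k + (\<Sum>i\<in>S. G y $ i * h $ i)"
          using 2 by simp
        moreover have "real (card (insert k S)) * (e / ?n * norm h) = real (card S) * (e / ?n * norm h) + e / ?n * norm h"
        proof -
          have "real (card (insert k S)) = real (card S) + 1" using 2 by simp
          then show ?thesis by (simp only: distrib_right mult_1)
        qed
        ultimately show ?case using 2(3) by linarith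
      qed
      from this[of UNIV] have "\<bar>f (y + part UNIV) - f y - (\<Sum>k\<in>UNIV. G y $ k * h $ k)\<bar> \<le> e * norm h"
        by simp
      moreover have "part UNIV = h" by (simp add: part_def vec_eq_iff)
      ultimately show ?thesis by (simp add: h_def inner_vec_def)
    qed
    then show "\<exists>d>0. \<forall>z. norm (z - y) < d \<longrightarrow> norm (f z - f y - G y \<bullet> (z - y)) \<le> e * norm (z - y)"
      using \<delta>(1) by blast
  qed
qed

text \<open>
  Applying the mean value theorem to the difference of the two functions along their lines, instead of
  to each of them, yields the same parameter \<open>s\<close> in both gradients. The gradients are then evaluated at comparable
  points, and no second derivative is needed to estimate the right-hand side.
\<close>

lemma increment_difference:
  fixes f1 f2 :: "real^'m \<Rightarrow> real"
  assumes "\<And>p. (f1 has_derivative (\<lambda>h. G1 p \<bullet> h)) (at p)" "\<And>p. (f2 has_derivative (\<lambda>h. G2 p \<bullet> h)) (at p)"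
  shows "\<exists>s\<in>{0..1}. (f1 (y1 + v1) - f1 y1) - (f2 (y2 + v2) - f2 y2)
     = G1 (y1 + s *\<^sub>R v1) \<bullet> v1 - G2 (y2 + s *\<^sub>R v2) \<bullet> v2"
proof -
  have line: "((\<lambda>s. f (p + s *\<^sub>R v)) has_real_derivative G (p + s *\<^sub>R v) \<bullet> v) (at s)"
    if "\<And>p. (f has_derivative (\<lambda>h. G p \<bullet> h)) (at p)" for f :: "real^'m \<Rightarrow> real" and G p v s
    unfolding has_field_derivative_def
    by (rule has_derivative_eq_rhs, rule has_derivative_compose[OF _ that])
       (auto intro!: derivative_eq_intros simp: fun_eq_iff)
  let ?\<phi> = "\<lambda>s. f1 (y1 + s *\<^sub>R v1) - f2 (y2 + s *\<^sub>R v2)"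
  have "\<exists>s. 0 < s \<and> s < 1 \<and> ?\<phi> 1 - ?\<phi> 0 = (1 - 0) * (G1 (y1 + s *\<^sub>R v1) \<bullet> v1 - G2 (y2 + s *\<^sub>R v2) \<bullet> v2)"
    by (rule MVT2) (auto intro!: DERIV_diff line assms)
  then show ?thesis by (force simp: algebra_simps)
qed

lemma powr_le_one_plus: "0 \<le> u \<Longrightarrow> 0 < \<theta> \<Longrightarrow> \<theta> \<le> 1 \<Longrightarrow> u powr \<theta> \<le> 1 + u" for u \<theta> :: real
proof (cases "u \<le> 1")
  case True
  moreover assume "0 \<le> u" "0 < \<theta>" "\<theta> \<le> 1"
  ultimately have "u powr \<theta> \<le> 1" by (intro powr_le1) auto
  then show ?thesis using \<open>0 \<le> u\<close> by simp
next
  case False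
  moreover assume "0 \<le> u" "0 < \<theta>" "\<theta> \<le> 1"
  ultimately have "u powr \<theta> \<le> u powr 1" by (intro powr_mono) auto
  then show ?thesis using \<open>0 \<le> u\<close> by simp
qed

text \<open>
  The quantitative content of being continuous and Hoelder except in the \<open>j\<close>-th variable, for positions in a
  bounded set: all the estimates below use a coefficient or its gradient only through the constant \<open>L\<close>. The bound
  \<open>real CARD('d) * R\<close> is one for the norm of a vector whose entries are bounded by \<open>R\<close>.
\<close>

definition controlled ::
    "real \<Rightarrow> 'd \<Rightarrow> real \<Rightarrow> real \<Rightarrow> (real \<Rightarrow> real^'m \<Rightarrow> real^'d \<Rightarrow> 'b::real_normed_vector) \<Rightarrow> bool" where
  "controlled \<theta> j R L \<Phi> \<longleftrightarrow>
     (\<forall>t\<in>{0..1}. \<forall>t'\<in>{0..1}. \<forall>y y' x x'. x $ j = x' $ j \<and> x $ j \<in> {-R..R} \<longrightarrow>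
        norm (\<Phi> t y x - \<Phi> t' y' x') \<le> L * (\<bar>t - t'\<bar> powr \<theta> + norm (y - y') powr \<theta> + norm (x - x') powr \<theta>)) \<and>
     (\<forall>t\<in>{0..1}. \<forall>y x. x $ j \<in> {-R..R} \<and> norm x \<le> real CARD('d) * R \<longrightarrow> norm (\<Phi> t y x) \<le> L * (1 + norm y))"

lemma controlledD:
  fixes \<Phi> :: "real \<Rightarrow> real^'m \<Rightarrow> real^'d \<Rightarrow> 'b::real_normed_vector"
  assumes "controlled \<theta> j R L \<Phi>" "t \<in> {0..1}" "x $ j \<in> {-R..R}"
  shows "t' \<in> {0..1} \<Longrightarrow> x $ j = x' $ j \<Longrightarrow>
      norm (\<Phi> t y x - \<Phi> t' y' x') \<le> L * (\<bar>t - t'\<bar> powr \<theta> + norm (y - y') powr \<theta> + norm (x - x') powr \<theta>)"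
    "norm x \<le> real CARD('d) * R \<Longrightarrow> norm (\<Phi> t y x) \<le> L * (1 + norm y)"
  using assms unfolding controlled_def by blast+

lemma controlled_mono:
  fixes \<Phi> :: "real \<Rightarrow> real^'m \<Rightarrow> real^'d \<Rightarrow> 'b::real_normed_vector"
  assumes c: "controlled \<theta> j R L \<Phi>" and le: "L \<le> L'"
  shows "controlled \<theta> j R L' \<Phi>"
  unfolding controlled_def
proof (intro conjI ballI allI impI)
  fix t t' :: real and y y' :: "real^'m" and x x' :: "real^'d"
  assume "t \<in> {0..1}" "t' \<in> {0..1}" "x $ j = x' $ j \<and> x $ j \<in> {-R..R}"
  then have "norm (\<Phi> t y x - \<Phi> t' y' x') \<le> L * (\<bar>t - t'\<bar> powr \<theta> + norm (y - y') powr \<theta> + norm (x - x') powr \<theta>)"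
    by (intro controlledD[OF c]) auto
  also have "\<dots> \<le> L' * (\<bar>t - t'\<bar> powr \<theta> + norm (y - y') powr \<theta> + norm (x - x') powr \<theta>)"
    using le by (intro mult_right_mono) auto
  finally show "norm (\<Phi> t y x - \<Phi> t' y' x') \<le> L' * (\<bar>t - t'\<bar> powr \<theta> + norm (y - y') powr \<theta> + norm (x - x') powr \<theta>)" .
next
  fix t :: real and y :: "real^'m" and x :: "real^'d"
  assume "t \<in> {0..1}" "x $ j \<in> {-R..R} \<and> norm x \<le> real CARD('d) * R"
  then have "norm (\<Phi> t y x) \<le> L * (1 + norm y)" by (intro controlledD[OF c]) auto
  also have "\<dots> \<le> L' * (1 + norm y)" using le by (intro mult_right_mono) auto
  finally show "norm (\<Phi> t y x) \<le> L' * (1 + norm y)" .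
qed

text \<open>
  The Hoelder bound holds for all \<open>y\<close>, so it also bounds the growth in \<open>y\<close>, by comparison with the values at \<open>t = 0\<close>
  and \<open>y = 0\<close>, where \<open>x\<close> ranges over a compact set.
\<close>

lemma holder_except_controlled:
  fixes \<Phi> :: "real \<Rightarrow> real^'m \<Rightarrow> real^'d \<Rightarrow> 'b::real_normed_vector"
  assumes h: "holder_except \<theta> j \<Phi>" and c: "continuous_coeff \<Phi>" and \<theta>: "0 < \<theta>" "\<theta> \<le> 1"
  shows "\<exists>L. controlled \<theta> j R L \<Phi>"
proof -
  define R' where "R' = real CARD('d) * R"
  obtain L0 where L0: "\<And>t t' y y' x x'. t \<in> {0..1} \<Longrightarrow> t' \<in> {0..1} \<Longrightarrow> x $ j = x' $ j \<Longrightarrow> x $ j \<in> {-R..R} \<Longrightarrow>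
      norm (\<Phi> t y x - \<Phi> t' y' x') \<le> L0 * (\<bar>t - t'\<bar> powr \<theta> + norm (y - y') powr \<theta> + norm (x - x') powr \<theta>)"
    using h[unfolded holder_except_def, rule_format, of "{-R..R}"] by blast
  have "continuous_on (cball 0 R') (\<lambda>x. (\<lambda>(t, y, x). \<Phi> t y x) (0, 0, x))"
    using c unfolding continuous_coeff_def
    by (rule continuous_on_compose2) (auto intro!: continuous_intros)
  then have "bounded ((\<lambda>x. \<Phi> 0 0 x) ` cball 0 R')"
    by (intro compact_imp_bounded compact_continuous_image) auto
  then obtain A where A: "\<And>x. norm x \<le> R' \<Longrightarrow> norm (\<Phi> 0 0 x) \<le> A" by (fastforce simp: bounded_iff)
  define L where "L = 2 * \<bar>L0\<bar> + \<bar>A\<bar>"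
  have 1: "norm (\<Phi> t y x - \<Phi> t' y' x') \<le> L * (\<bar>t - t'\<bar> powr \<theta> + norm (y - y') powr \<theta> + norm (x - x') powr \<theta>)"
    if "t \<in> {0..1}" "t' \<in> {0..1}" "x $ j = x' $ j" "x $ j \<in> {-R..R}" for t t' y y' x x'
    by (rule order_trans[OF L0[OF that]], rule mult_right_mono) (auto simp: L_def)
  have 2: "norm (\<Phi> t y x) \<le> L * (1 + norm y)" if t: "t \<in> {0..1}" and x: "x $ j \<in> {-R..R}" "norm x \<le> R'" for t y x
  proof -
    have y\<theta>: "norm y powr \<theta> \<le> 1 + norm y" using \<theta> by (intro powr_le_one_plus) auto
    have t\<theta>: "t powr \<theta> \<le> 1" using t \<theta> by (intro powr_le1) auto
    have "norm (\<Phi> t y x) \<le> norm (\<Phi> t y x - \<Phi> 0 0 x) + norm (\<Phi> 0 0 x)"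
      using norm_triangle_sub[of "\<Phi> t y x" "\<Phi> 0 0 x"] by simp
    also have "\<dots> \<le> L0 * (t powr \<theta> + norm y powr \<theta>) + A"
      using L0[of t 0 x x y 0] t x A[OF x(2)] by simp
    also have "\<dots> \<le> \<bar>L0\<bar> * (1 + (1 + norm y)) + \<bar>A\<bar> * (1 + norm y)"
    proof (rule add_mono)
      show "L0 * (t powr \<theta> + norm y powr \<theta>) \<le> \<bar>L0\<bar> * (1 + (1 + norm y))"
        using y\<theta> t\<theta> by (intro mult_mono) auto
      have "A \<le> \<bar>A\<bar> * 1" by simp
      also have "\<dots> \<le> \<bar>A\<bar> * (1 + norm y)" by (intro mult_left_mono) auto
      finally show "A \<le> \<bar>A\<bar> * (1 + norm y)" .
    qed
    also have "\<dots> \<le> L * (1 + norm y)" by (simp add: L_def algebra_simps)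
    finally show ?thesis .
  qed
  from 1 2 show ?thesis unfolding controlled_def R'_def by blast
qed

lemma has_y_gradient_has_derivative:
  fixes \<Phi> :: "real \<Rightarrow> real^'m \<Rightarrow> real^'d \<Rightarrow> real"
  assumes "has_y_gradient \<Phi> D" "continuous_coeff D" "0 \<le> t"
  shows "((\<lambda>p. \<Phi> t p x) has_derivative (\<lambda>h. D t p x \<bullet> h)) (at p)"
proof (rule has_derivative_of_continuous_partials)
  show "((\<lambda>s. \<Phi> t (y + s *\<^sub>R axis k 1) x) has_real_derivative D t y x $ k) (at 0)" for y k
    using assms unfolding has_y_gradient_def by blast
  have "continuous_on UNIV (\<lambda>p. (\<lambda>(t, y, x). D t y x) (t, p, x))"
    using assms(2) unfolding continuous_coeff_def
    by (rule continuous_on_compose2) (use assms(3) in \<open>auto intro!: continuous_intros\<close>)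
  then show "continuous_on UNIV (\<lambda>p. D t p x)" by simp
qed

section \<open>The path integral of a controlled coefficient\<close>

definition moved :: "(real \<Rightarrow> real^'d) \<Rightarrow> 'd \<Rightarrow> real \<Rightarrow> real \<Rightarrow> real^'d" where
  "moved x j t \<xi> = (\<chi> l. if l = j then \<xi> else x t $ l)"

lemma moved_nth [simp]: "moved x j t \<xi> $ j = \<xi>" by (simp add: moved_def)

lemma norm_moved_diff_le: "norm (moved x j s \<xi> - moved x j t \<xi>) \<le> norm (x s - x t)"
  by (rule norm_le_componentwise_cart) (simp add: moved_def)

lemma integrand_eq: "integrand F y x i j t \<xi> = F t (y t) (moved x j t \<xi>) $ i $ j"
  by (simp add: integrand_def moved_def)

text \<open>
  The driving path, the coefficient and the gradients \<open>D i j\<close> of its entries, with constants that do not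
  depend on the indices. The exponent \<open>\<kappa>\<close> is the one in which the integrands are Hoelder in time.
\<close>

locale driven_equation =
  fixes \<alpha> \<beta> \<gamma> \<theta> \<kappa> T C R N L :: real
    and F :: "real \<Rightarrow> real^'m \<Rightarrow> real^'d \<Rightarrow> real^'d^'m"
    and D :: "'m \<Rightarrow> 'd \<Rightarrow> real \<Rightarrow> real^'m \<Rightarrow> real^'d \<Rightarrow> real^'m"
    and x :: "real \<Rightarrow> real^'d"
  assumes exps: "0 < \<beta>" "\<beta> \<le> \<alpha>" "\<alpha> \<le> 1" "0 < \<theta>" "\<theta> \<le> 1" "\<beta> < \<kappa> + \<gamma>" "\<kappa> \<le> \<theta> * \<beta>"
    and signal: "\<And>j. scalar_signal (\<lambda>t. x t $ j) T \<alpha> C R N \<kappa> \<gamma>"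
    and x_holder: "\<And>s t. s \<in> {0..T} \<Longrightarrow> t \<in> {0..T} \<Longrightarrow> norm (x s - x t) \<le> C * \<bar>s - t\<bar> powr \<alpha>"
    and L: "0 \<le> L"
    and F_continuous: "\<And>i j. continuous_coeff (\<lambda>t y x. F t y x $ i $ j)"
    and F_controlled: "\<And>i j. controlled \<theta> j R L (\<lambda>t y x. F t y x $ i $ j)"
    and D_derivative: "\<And>i j t p x. 0 \<le> t \<Longrightarrow> ((\<lambda>p. F t p x $ i $ j) has_derivative (\<lambda>h. D i j t p x \<bullet> h)) (at p)"
    and D_controlled: "\<And>i j. controlled \<theta> j R L (D i j)"
begin

lemma T: "0 \<le> T" "T \<le> 1" and C: "0 \<le> C"
  using scalar_signal.T[OF signal] scalar_signal.constants[OF signal] by auto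

lemma norm_moved_le:
  assumes "t \<in> {0..T}" "\<xi> \<in> {-R..R}"
  shows "norm (moved x j t \<xi>) \<le> real CARD('d) * R"
proof -
  have "norm (moved x j t \<xi>) \<le> (\<Sum>l\<in>UNIV. \<bar>moved x j t \<xi> $ l\<bar>)" by (rule norm_le_l1_cart)
  also have "\<dots> \<le> (\<Sum>l\<in>(UNIV::'d set). R)"
    using assms scalar_signal.bounded[OF signal] by (intro sum_mono) (auto simp: moved_def abs_le_iff)
  finally show ?thesis by simp
qed

lemma integrand_continuous:
  assumes "0 \<le> t" shows "continuous_on UNIV (integrand F y x i j t)"
proof -
  have "continuous_on UNIV (\<lambda>\<xi>. (\<lambda>(t, y, x). F t y x $ i $ j) (t, y t, moved x j t \<xi>))"
    using F_continuous[of i j] unfolding continuous_coeff_def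
  proof (rule continuous_on_compose2)
    have "continuous_on UNIV (moved x j t)"
      unfolding moved_def[abs_def]
    proof (rule continuous_on_vec_lambda)
      show "continuous_on UNIV (\<lambda>\<xi>. if l = j then \<xi> else x t $ l)" for l
        by (cases "l = j") (auto intro!: continuous_intros)
    qed
    then show "continuous_on UNIV (\<lambda>\<xi>. (t, y t, moved x j t \<xi>))" by (intro continuous_intros)
  qed (use assms in auto)
  then show ?thesis by (simp add: integrand_eq[abs_def])
qed

text \<open>
  All exponents that occur are at least \<open>\<theta> * \<beta>\<close>, hence at least \<open>\<kappa>\<close>, and times differ by at most 1.
\<close>

lemma modulus_le:
  assumes st: "s \<in> {0..T}" "t \<in> {0..T}" and p: "norm (p - q) \<le> M * \<bar>s - t\<bar> powr \<beta>" and M: "0 \<le> M"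
  shows "\<bar>s - t\<bar> powr \<theta> + norm (p - q) powr \<theta> + norm (moved x j s \<xi> - moved x j t \<xi>) powr \<theta>
    \<le> (3 + C + M) * \<bar>s - t\<bar> powr \<kappa>"
proof -
  let ?u = "\<bar>s - t\<bar>"
  have u: "0 \<le> ?u" "?u \<le> 1" using st T by auto
  have \<theta>\<beta>: "\<theta> * \<beta> \<le> \<theta>" "\<theta> * \<beta> \<le> \<theta> * \<alpha>" using exps by (auto simp: mult_left_le)
  then have \<kappa>\<alpha>: "\<kappa> \<le> \<theta> * \<alpha>" and \<kappa>\<theta>: "\<kappa> \<le> \<theta>" using exps by linarith+
  have 1: "?u powr \<theta> \<le> ?u powr \<kappa>" using u \<kappa>\<theta> by (intro powr_mono') auto
  have scaled: "r powr \<theta> \<le> (1 + B) * ?u powr \<kappa>" if r: "0 \<le> r" "r \<le> B * ?u powr \<delta>" and B: "0 \<le> B" and \<delta>: "\<kappa> \<le> \<theta> * \<delta>" for r B \<delta>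
  proof -
    have "r powr \<theta> \<le> (B * ?u powr \<delta>) powr \<theta>" using r exps by (intro powr_mono2) auto
    also have "\<dots> = B powr \<theta> * ?u powr (\<theta> * \<delta>)" using B by (simp add: powr_mult powr_powr mult.commute)
    also have "\<dots> \<le> (1 + B) * ?u powr \<kappa>"
      using B exps u \<delta> by (intro mult_mono powr_le_one_plus powr_mono') auto
    finally show ?thesis .
  qed
  have 2: "norm (p - q) powr \<theta> \<le> (1 + M) * ?u powr \<kappa>" using p M exps by (intro scaled[where \<delta> = \<beta>]) auto
  have "norm (moved x j s \<xi> - moved x j t \<xi>) \<le> C * ?u powr \<alpha>"
    using norm_moved_diff_le x_holder[OF st] by (rule order_trans)
  then have 3: "norm (moved x j s \<xi> - moved x j t \<xi>) powr \<theta> \<le> (1 + C) * ?u powr \<kappa>"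
    using C \<kappa>\<alpha> by (intro scaled[where \<delta> = \<alpha>]) auto
  from 1 2 3 show ?thesis by (simp add: distrib_right)
qed

lemma tame_integrand:
  assumes y: "holder_on \<beta> a b M y" and M: "0 \<le> M" and ab: "0 \<le> a" "a \<le> b" "b \<le> T"
  shows "tame \<kappa> R a b (L * (1 + norm (y a) + M * (b - a) powr \<beta>)) (L * (3 + C + M)) (integrand F y x i j)"
  unfolding tame_def
proof (intro conjI allI impI ballI)
  show "0 \<le> L * (1 + norm (y a) + M * (b - a) powr \<beta>)" "0 \<le> L * (3 + C + M)" using L M C by auto
  show "continuous_on UNIV (integrand F y x i j t)" if "0 \<le> t" for t by (rule integrand_continuous[OF that])
next
  fix t \<xi> assume t: "t \<in> {a..b}" and \<xi>: "\<xi> \<in> {-R..R}"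
  have t01: "t \<in> {0..1}" "t \<in> {0..T}" using t ab T by auto
  have "\<bar>integrand F y x i j t \<xi>\<bar> \<le> L * (1 + norm (y t))"
    using controlledD(2)[OF F_controlled t01(1)] \<xi> norm_moved_le[OF t01(2) \<xi>] by (simp add: integrand_eq)
  also have "\<dots> \<le> L * (1 + norm (y a) + M * (b - a) powr \<beta>)"
  proof (rule mult_left_mono[OF _ L])
    have "norm (y t - y a) \<le> M * \<bar>t - a\<bar> powr \<beta>" using holder_onD[OF y t, of a] ab by auto
    also have "\<dots> \<le> M * (b - a) powr \<beta>" using t M exps by (intro mult_left_mono powr_mono2) auto
    finally show "1 + norm (y t) \<le> 1 + norm (y a) + M * (b - a) powr \<beta>"
      using norm_triangle_sub[of "y t" "y a"] by simp
  qed
  finally show "\<bar>integrand F y x i j t \<xi>\<bar> \<le> L * (1 + norm (y a) + M * (b - a) powr \<beta>)" .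
next
  fix s t \<xi> assume s: "s \<in> {a..b}" and t: "t \<in> {a..b}" and \<xi>: "\<xi> \<in> {-R..R}"
  have st: "s \<in> {0..1}" "s \<in> {0..T}" "t \<in> {0..1}" "t \<in> {0..T}" using s t ab T by auto
  have "\<bar>integrand F y x i j s \<xi> - integrand F y x i j t \<xi>\<bar>
     \<le> L * (\<bar>s - t\<bar> powr \<theta> + norm (y s - y t) powr \<theta> + norm (moved x j s \<xi> - moved x j t \<xi>) powr \<theta>)"
    using controlledD(1)[OF F_controlled st(1) _ st(3)] \<xi> by (simp add: integrand_eq)
  also have "\<dots> \<le> L * ((3 + C + M) * \<bar>s - t\<bar> powr \<kappa>)"
    using st M holder_onD[OF y s t] by (intro mult_left_mono[OF _ L] modulus_le) auto
  finally show "\<bar>integrand F y x i j s \<xi> - integrand F y x i j t \<xi>\<bar> \<le> L * (3 + C + M) * \<bar>s - t\<bar> powr \<kappa>"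
    by (simp add: mult.assoc)
qed

text \<open>
  Both constants are proportional to the Hoelder constant \<open>d\<close> of the difference of the paths, and the supremum has the
  additional factor \<open>(b - a) powr \<beta>\<close>, since the paths agree at \<open>a\<close>.
\<close>

lemma tame_integrand_diff:
  assumes y: "holder_on \<beta> a b M y" and z: "holder_on \<beta> a b M z" and M: "0 \<le> M"
    and Q: "\<And>u. u \<in> {a..b} \<Longrightarrow> norm (y u) \<le> Q" "\<And>u. u \<in> {a..b} \<Longrightarrow> norm (z u) \<le> Q"
    and init: "y a = z a" and d: "holder_on \<beta> a b d (\<lambda>u. z u - y u)" "0 \<le> d"
    and ab: "0 \<le> a" "a \<le> b" "b \<le> T"
  shows "tame \<kappa> R a b (L * (1 + Q) * d * (b - a) powr \<beta>) (L * (4 + C + M + Q) * d)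
    (\<lambda>t \<xi>. integrand F z x i j t \<xi> - integrand F y x i j t \<xi>)"
  unfolding tame_def
proof (intro conjI allI impI ballI)
  have Q0: "0 \<le> Q" using Q(1)[of a] ab norm_ge_zero[of "y a"] by (simp del: norm_ge_zero)
  show "0 \<le> L * (1 + Q) * d * (b - a) powr \<beta>" "0 \<le> L * (4 + C + M + Q) * d" using L M C Q0 d by auto
  show "continuous_on UNIV (\<lambda>\<xi>. integrand F z x i j t \<xi> - integrand F y x i j t \<xi>)" if "0 \<le> t" for t
    by (intro continuous_on_diff integrand_continuous that)
  define v where "v u = z u - y u" for u
  have zv: "z u = y u + v u" for u by (simp add: v_def)
  have v_le: "norm (v u) \<le> d * (b - a) powr \<beta>" if u: "u \<in> {a..b}" for u
  proof -
    have "norm (v u) \<le> d * \<bar>u - a\<bar> powr \<beta>"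
      using holder_onD[OF d(1) u, of a] ab init by (auto simp: v_def)
    also have "\<dots> \<le> d * (b - a) powr \<beta>" using u d exps by (intro mult_left_mono powr_mono2) auto
    finally show ?thesis .
  qed
  have v_le_d: "norm (v u) \<le> d" if u: "u \<in> {a..b}" for u
  proof -
    have "d * (b - a) powr \<beta> \<le> d * 1" using ab T d exps by (intro mult_left_mono powr_le1) auto
    then show ?thesis using v_le[OF u] by simp
  qed
  have mid: "norm (y u + r *\<^sub>R v u) \<le> Q" if "u \<in> {a..b}" "r \<in> {0..1}" for u r
  proof -
    have "y u + r *\<^sub>R v u = (1 - r) *\<^sub>R y u + r *\<^sub>R z u" by (simp add: v_def algebra_simps)
    also have "norm \<dots> \<le> (1 - r) * norm (y u) + r * norm (z u)"
      using norm_triangle_ineq[of "(1 - r) *\<^sub>R y u" "r *\<^sub>R z u"] that by simp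
    also have "\<dots> \<le> (1 - r) * Q + r * Q" using Q that by (intro add_mono mult_left_mono) auto
    finally show ?thesis by (simp add: algebra_simps)
  qed
  have mid_diff: "norm ((y s + r *\<^sub>R v s) - (y t + r *\<^sub>R v t)) \<le> M * \<bar>s - t\<bar> powr \<beta>"
    if "s \<in> {a..b}" "t \<in> {a..b}" "r \<in> {0..1}" for s t r
  proof -
    have "(y s + r *\<^sub>R v s) - (y t + r *\<^sub>R v t) = (1 - r) *\<^sub>R (y s - y t) + r *\<^sub>R (z s - z t)"
      by (simp add: v_def algebra_simps)
    also have "norm \<dots> \<le> (1 - r) * norm (y s - y t) + r * norm (z s - z t)"
      using norm_triangle_ineq[of "(1 - r) *\<^sub>R (y s - y t)" "r *\<^sub>R (z s - z t)"] that by simp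
    also have "\<dots> \<le> (1 - r) * (M * \<bar>s - t\<bar> powr \<beta>) + r * (M * \<bar>s - t\<bar> powr \<beta>)"
      using holder_onD[OF y that(1,2)] holder_onD[OF z that(1,2)] that by (intro add_mono mult_left_mono) auto
    finally show ?thesis by (simp add: algebra_simps)
  qed
  have D_le: "norm (D i j t (y t + r *\<^sub>R v t) (moved x j t \<xi>)) \<le> L * (1 + Q)"
    if t: "t \<in> {a..b}" and r: "r \<in> {0..1}" and \<xi>: "\<xi> \<in> {-R..R}" for t r \<xi>
  proof -
    have t01: "t \<in> {0..1}" "t \<in> {0..T}" using t ab T by auto
    have "norm (D i j t (y t + r *\<^sub>R v t) (moved x j t \<xi>)) \<le> L * (1 + norm (y t + r *\<^sub>R v t))"
      using t01 \<xi> norm_moved_le[OF t01(2) \<xi>] by (intro controlledD(2)[OF D_controlled]) auto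
    also have "\<dots> \<le> L * (1 + Q)" using mid[OF t r] by (intro mult_left_mono[OF _ L]) auto
    finally show ?thesis .
  qed
  {
    fix t \<xi> assume t: "t \<in> {a..b}" and \<xi>: "\<xi> \<in> {-R..R}"
    have t0: "0 \<le> t" using t ab by auto
    let ?f = "\<lambda>p. F t p (moved x j t \<xi>) $ i $ j" and ?G = "\<lambda>p. D i j t p (moved x j t \<xi>)"
    obtain r where r: "r \<in> {0..1}" and e: "?f (y t + v t) - ?f (y t) - (0 - 0) = ?G (y t + r *\<^sub>R v t) \<bullet> v t - 0 \<bullet> v t"
      using increment_difference[of ?f ?G "\<lambda>_. 0" "\<lambda>_. 0" "y t" "v t" "y t" "v t"] D_derivative[OF t0] by auto
    have "\<bar>integrand F z x i j t \<xi> - integrand F y x i j t \<xi>\<bar> = \<bar>?G (y t + r *\<^sub>R v t) \<bullet> v t\<bar>"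
      using e by (simp add: integrand_eq zv)
    also have "\<dots> \<le> norm (?G (y t + r *\<^sub>R v t)) * norm (v t)" by (rule Cauchy_Schwarz_ineq2)
    also have "\<dots> \<le> L * (1 + Q) * (d * (b - a) powr \<beta>)"
      using D_le[OF t r \<xi>] v_le[OF t] L Q0 by (intro mult_mono) auto
    finally show "\<bar>integrand F z x i j t \<xi> - integrand F y x i j t \<xi>\<bar> \<le> L * (1 + Q) * d * (b - a) powr \<beta>"
      by (simp add: mult.assoc)
  }
  fix s t \<xi> assume s: "s \<in> {a..b}" and t: "t \<in> {a..b}" and \<xi>: "\<xi> \<in> {-R..R}"
  have st: "s \<in> {0..1}" "s \<in> {0..T}" "t \<in> {0..1}" "t \<in> {0..T}" using s t ab T by auto
  let ?f = "\<lambda>t p. F t p (moved x j t \<xi>) $ i $ j" and ?G = "\<lambda>t p. D i j t p (moved x j t \<xi>)"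
  let ?u = "\<bar>s - t\<bar>"
  obtain r where r: "r \<in> {0..1}" and e: "?f s (y s + v s) - ?f s (y s) - (?f t (y t + v t) - ?f t (y t))
      = ?G s (y s + r *\<^sub>R v s) \<bullet> v s - ?G t (y t + r *\<^sub>R v t) \<bullet> v t"
    using increment_difference[of "?f s" "?G s" "?f t" "?G t" "y s" "v s" "y t" "v t"] D_derivative st by auto
  define p q where "p = ?G s (y s + r *\<^sub>R v s)" and "q = ?G t (y t + r *\<^sub>R v t)"
  have pq: "norm (p - q) \<le> L * ((3 + C + M) * ?u powr \<kappa>)"
  proof -
    have "norm (p - q) \<le> L * (?u powr \<theta> + norm ((y s + r *\<^sub>R v s) - (y t + r *\<^sub>R v t)) powr \<theta>
        + norm (moved x j s \<xi> - moved x j t \<xi>) powr \<theta>)"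
      unfolding p_def q_def using st \<xi> by (intro controlledD(1)[OF D_controlled]) auto
    also have "\<dots> \<le> L * ((3 + C + M) * ?u powr \<kappa>)"
      using st M mid_diff[OF s t r] by (intro mult_left_mono[OF _ L] modulus_le) auto
    finally show ?thesis .
  qed
  have vv: "norm (v s - v t) \<le> d * ?u powr \<kappa>"
  proof -
    have "norm (v s - v t) \<le> d * ?u powr \<beta>" using holder_onD[OF d(1) s t] by (simp add: v_def)
    also have "\<dots> \<le> d * ?u powr \<kappa>"
    proof -
      \<comment> \<open>The linear term in the increment of the paths has the exponent \<open>\<beta>\<close>, which is at least \<open>\<kappa>\<close>.\<close>
      have "\<theta> * \<beta> \<le> \<beta>" using exps by (simp add: mult_left_le_one_le)
      then have "\<kappa> \<le> \<beta>" using exps by linarith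
      then show ?thesis using st T exps d by (intro mult_left_mono powr_mono') auto
    qed
    finally show ?thesis .
  qed
  have "\<bar>integrand F z x i j s \<xi> - integrand F y x i j s \<xi> - (integrand F z x i j t \<xi> - integrand F y x i j t \<xi>)\<bar>
     = \<bar>p \<bullet> v s - q \<bullet> v t\<bar>"
    using e by (simp add: integrand_eq zv p_def q_def)
  also have "p \<bullet> v s - q \<bullet> v t = (p - q) \<bullet> v s + q \<bullet> (v s - v t)"
    by (simp add: inner_diff_left inner_diff_right)
  also have "\<bar>\<dots>\<bar> \<le> norm (p - q) * norm (v s) + norm q * norm (v s - v t)"
    using Cauchy_Schwarz_ineq2[of "p - q" "v s"] Cauchy_Schwarz_ineq2[of q "v s - v t"]
      abs_triangle_ineq[of "(p - q) \<bullet> v s" "q \<bullet> (v s - v t)"] by linarith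
  also have "\<dots> \<le> L * ((3 + C + M) * ?u powr \<kappa>) * d + L * (1 + Q) * (d * ?u powr \<kappa>)"
    using pq vv v_le_d[OF s] D_le[OF t r \<xi>] L M C Q0
    by (intro add_mono mult_mono) (auto simp: q_def)
  also have "\<dots> = L * (4 + C + M + Q) * d * ?u powr \<kappa>" by (simp add: algebra_simps)
  finally show "\<bar>integrand F z x i j s \<xi> - integrand F y x i j s \<xi> - (integrand F z x i j t \<xi> - integrand F y x i j t \<xi>)\<bar>
    \<le> L * (4 + C + M + Q) * d * ?u powr \<kappa>" .
qed

end

context driven_equation
begin

definition path_const :: real where "path_const = scalar_signal.integral_const \<alpha> C N"
text \<open>
  The smaller one of the two gains: \<open>\<kappa> + \<gamma> - \<beta>\<close> from the regularity of the integrand in time, and \<open>\<beta>\<close> from paths being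
  close to their value at the left end point.
\<close>

definition \<epsilon> :: real where "\<epsilon> = min \<beta> (\<kappa> + \<gamma> - \<beta>)"
definition K :: real where "K = real CARD('m) * real CARD('d) * path_const * L * (4 + C)"
definition \<Lambda> :: "real \<Rightarrow> real \<Rightarrow> real" where
  "\<Lambda> Q M = real CARD('m) * real CARD('d) * path_const * L * (5 + C + \<bar>M\<bar> + 2 * \<bar>Q\<bar>)"

lemma path_const_nonneg: "0 \<le> path_const" unfolding path_const_def by (rule scalar_signal.integral_const_nonneg[OF signal])

lemma \<epsilon>_pos: "0 < \<epsilon>" using exps by (simp add: \<epsilon>_def)

text \<open>
  Measured with the exponent \<open>\<beta>\<close>, the part of the integral that depends on the regularity in time gains the
  factor \<open>(b - a) powr \<epsilon>\<close>; the part that depends on the supremum does not gain anything.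
\<close>

lemma component_integral:
  assumes "tame \<kappa> R a b A B f" "0 \<le> a" "a \<le> s" "s \<le> t" "t \<le> b" "b \<le> T"
  shows "dyadic_integrable f (\<lambda>t. x t $ j) s t"
    "\<bar>dyadic_integral f (\<lambda>t. x t $ j) s t\<bar> \<le> path_const * ((A + B * (b - a) powr \<epsilon>) * (t - s) powr \<beta>)"
proof -
  have tame: "tame \<kappa> R s t A B f" using assms by (auto intro: tame_mono)
  have AB: "0 \<le> A" "0 \<le> B" using tameD[OF tame] by auto
  have st: "0 \<le> s" "s \<le> t" "t \<le> T" using assms by auto
  show "dyadic_integrable f (\<lambda>t. x t $ j) s t"
    by (rule scalar_signal.dyadic_integral_exists_le[OF signal tame st])
  have "\<bar>dyadic_integral f (\<lambda>t. x t $ j) s t\<bar> \<le> path_const * (A * (t - s) powr \<alpha> + B * (t - s) powr (\<kappa> + \<gamma>))"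
    unfolding path_const_def by (rule scalar_signal.dyadic_integral_exists_le[OF signal tame st])
  also have "\<dots> \<le> path_const * ((A + B * (b - a) powr \<epsilon>) * (t - s) powr \<beta>)"
  proof (rule mult_left_mono[OF _ path_const_nonneg])
    have "(t - s) powr \<alpha> \<le> (t - s) powr \<beta>" using exps st T by (intro powr_mono') auto
    moreover have "(t - s) powr (\<kappa> + \<gamma>) \<le> (b - a) powr \<epsilon> * (t - s) powr \<beta>"
    proof -
      have "(t - s) powr (\<kappa> + \<gamma>) = (t - s) powr (\<kappa> + \<gamma> - \<beta>) * (t - s) powr \<beta>"
        by (simp flip: powr_add)
      also have "(t - s) powr (\<kappa> + \<gamma> - \<beta>) \<le> (t - s) powr \<epsilon>"
        using st T by (intro powr_mono') (auto simp: \<epsilon>_def)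
      also have "\<dots> \<le> (b - a) powr \<epsilon>" using assms \<epsilon>_pos by (intro powr_mono2) auto
      finally show ?thesis by (simp add: mult_right_mono)
    qed
    ultimately show "A * (t - s) powr \<alpha> + B * (t - s) powr (\<kappa> + \<gamma>) \<le> (A + B * (b - a) powr \<epsilon>) * (t - s) powr \<beta>"
      using AB by (simp add: distrib_right mult.assoc add_mono mult_left_mono)
  qed
  finally show "\<bar>dyadic_integral f (\<lambda>t. x t $ j) s t\<bar> \<le> path_const * ((A + B * (b - a) powr \<epsilon>) * (t - s) powr \<beta>)" .
qed

lemma norm_double_sum_le:
  assumes "\<And>i j. \<bar>I i j\<bar> \<le> e"
  shows "norm (\<chi> i::'m. \<Sum>j\<in>(UNIV::'d set). I i j) \<le> real CARD('m) * real CARD('d) * e"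
proof -
  have "norm (\<chi> i::'m. \<Sum>j\<in>(UNIV::'d set). I i j) \<le> (\<Sum>i\<in>(UNIV::'m set). \<bar>\<Sum>j\<in>(UNIV::'d set). I i j\<bar>)"
    using norm_le_l1_cart[of "\<chi> i::'m. \<Sum>j\<in>(UNIV::'d set). I i j"] by simp
  also have "\<dots> \<le> (\<Sum>i\<in>(UNIV::'m set). \<Sum>j\<in>(UNIV::'d set). e)"
    by (intro sum_mono order_trans[OF sum_abs]) (rule assms)
  finally show ?thesis by simp
qed

lemma path_integrable:
  assumes "holder_on \<beta> s t M y" "0 \<le> M" "0 \<le> s" "s \<le> t" "t \<le> T"
  shows "path_integrable F y x s t"
  unfolding path_integrable_def
  using component_integral(1)[OF tame_integrand[OF assms] assms(3) order_refl assms(4) order_refl assms(5)] by blast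

lemma path_integral_growth:
  assumes y: "holder_on \<beta> a b M y" "0 \<le> M" and st: "0 \<le> a" "a \<le> s" "s \<le> t" "t \<le> b" "b \<le> T"
  shows "norm (path_integral F y x s t) \<le> K * (1 + norm (y a) + (b - a) powr \<epsilon> * (1 + M)) * (t - s) powr \<beta>"
proof -
  let ?n = "real CARD('m) * real CARD('d)" and ?e = "(b - a) powr \<epsilon>" and ?r = "(t - s) powr \<beta>"
  have ab: "a \<le> b" using st by auto
  have "norm (path_integral F y x s t)
     \<le> ?n * (path_const * ((L * (1 + norm (y a) + M * (b - a) powr \<beta>) + L * (3 + C + M) * ?e) * ?r))"
    unfolding path_integral_def
    by (rule norm_double_sum_le, rule component_integral(2)[OF tame_integrand[OF y st(1) ab st(5)] st])
  also have "\<dots> \<le> ?n * (path_const * ((L * ((4 + C) * (1 + norm (y a) + ?e * (1 + M)))) * ?r))"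
  proof (intro mult_left_mono mult_right_mono path_const_nonneg)
    have "(b - a) powr \<beta> \<le> ?e" using ab st T by (intro powr_mono') (auto simp: \<epsilon>_def)
    then have "M * (b - a) powr \<beta> \<le> ?e * M" using y(2) by (simp add: mult.commute mult_left_mono)
    then have "1 + norm (y a) + M * (b - a) powr \<beta> + (3 + C + M) * ?e \<le> 1 + norm (y a) + (3 + C + 2 * M) * ?e"
      by (simp add: algebra_simps)
    also have "\<dots> \<le> (4 + C) * (1 + norm (y a)) + ((4 + C) * (1 + M)) * ?e"
    proof (intro add_mono mult_right_mono)
      have "1 * (1 + norm (y a)) \<le> (4 + C) * (1 + norm (y a))" using C by (intro mult_right_mono) auto
      then show "1 + norm (y a) \<le> (4 + C) * (1 + norm (y a))" by simp
      have "0 \<le> C * M" using C y(2) by simp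
      then show "3 + C + 2 * M \<le> (4 + C) * (1 + M)" using y(2) C by (simp add: algebra_simps)
    qed simp
    finally have "1 + norm (y a) + M * (b - a) powr \<beta> + (3 + C + M) * ?e \<le> (4 + C) * (1 + norm (y a) + ?e * (1 + M))"
      by (simp add: algebra_simps)
    from mult_left_mono[OF this L]
    show "L * (1 + norm (y a) + M * (b - a) powr \<beta>) + L * (3 + C + M) * ?e \<le> L * ((4 + C) * (1 + norm (y a) + ?e * (1 + M)))"
      by (simp add: algebra_simps)
  qed auto
  finally show ?thesis by (simp add: K_def mult_ac)
qed

text \<open>
  The gain for the supremum part, missing in \<open>component_integral\<close>, comes from \<open>tame_integrand_diff\<close>.
\<close>

lemma path_integral_lipschitz:
  assumes y: "holder_on \<beta> a b M y" and z: "holder_on \<beta> a b M z" and M: "0 \<le> M"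
    and Q: "\<And>u. u \<in> {a..b} \<Longrightarrow> norm (y u) \<le> Q" "\<And>u. u \<in> {a..b} \<Longrightarrow> norm (z u) \<le> Q"
    and init: "y a = z a" and d: "holder_on \<beta> a b d (\<lambda>u. z u - y u)" "0 \<le> d"
    and st: "0 \<le> a" "a \<le> s" "s \<le> t" "t \<le> b" "b \<le> T"
  shows "norm (path_integral F z x s t - path_integral F y x s t)
    \<le> \<Lambda> Q M * (b - a) powr \<epsilon> * d * (t - s) powr \<beta>"
proof -
  let ?n = "real CARD('m) * real CARD('d)" and ?e = "(b - a) powr \<epsilon>" and ?r = "(t - s) powr \<beta>"
  have ab: "a \<le> b" using st by auto
  have Q0: "0 \<le> Q" using Q(1)[of a] ab norm_ge_zero[of "y a"] by (simp del: norm_ge_zero)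
  let ?I = "\<lambda>y i j. dyadic_integral (integrand F y x i j) (\<lambda>t. x t $ j) s t"
  let ?d = "\<lambda>i j. dyadic_integral (\<lambda>u \<xi>. integrand F z x i j u \<xi> - integrand F y x i j u \<xi>) (\<lambda>t. x t $ j) s t"
  have "?d i j = ?I z i j - ?I y i j" for i j
    using component_integral(1)[OF tame_integrand[OF y M st(1) ab st(5)] st]
      component_integral(1)[OF tame_integrand[OF z M st(1) ab st(5)] st] st T
    by (intro dyadic_integral_diff integrand_continuous) auto
  then have "path_integral F z x s t - path_integral F y x s t = (\<chi> i. \<Sum>j\<in>UNIV. ?d i j)"
    by (simp add: path_integral_def vec_eq_iff sum_subtractf)
  also have "norm \<dots> \<le> ?n * (path_const * ((L * (1 + Q) * d * (b - a) powr \<beta> + L * (4 + C + M + Q) * d * ?e) * ?r))"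
    by (rule norm_double_sum_le,
        rule component_integral(2)[OF tame_integrand_diff[OF y z M Q init d st(1) ab st(5)] st])
  also have "\<dots> \<le> ?n * (path_const * ((L * ((5 + C + M + 2 * Q) * (d * ?e))) * ?r))"
  proof (intro mult_left_mono mult_right_mono path_const_nonneg)
    have "(b - a) powr \<beta> \<le> ?e" using ab st T by (intro powr_mono') (auto simp: \<epsilon>_def)
    then have "L * (1 + Q) * d * (b - a) powr \<beta> \<le> L * (1 + Q) * d * ?e"
      using L Q0 d by (intro mult_left_mono) auto
    then show "L * (1 + Q) * d * (b - a) powr \<beta> + L * (4 + C + M + Q) * d * ?e \<le> L * ((5 + C + M + 2 * Q) * (d * ?e))"
      by (simp add: algebra_simps)
  qed auto
  finally show ?thesis using M Q0 by (simp add: \<Lambda>_def mult_ac)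
qed

lemma path_integral_additive:
  assumes y: "holder_on \<beta> s t M y" and st: "0 \<le> s" "s \<le> r" "r \<le> t" "t \<le> T"
  shows "path_integral F y x s t = path_integral F y x s r + path_integral F y x r t"
proof -
  have "holder_on \<beta> s t (max M 0) y" using y by (rule holder_on_mono) simp
  then have "tame \<kappa> R s t (L * (1 + norm (y s) + max M 0 * (t - s) powr \<beta>)) (L * (3 + C + max M 0)) (integrand F y x i j)" for i j
    using st by (intro tame_integrand) auto
  then have "dyadic_integral (integrand F y x i j) (\<lambda>t. x t $ j) s t
    = dyadic_integral (integrand F y x i j) (\<lambda>t. x t $ j) s r
      + dyadic_integral (integrand F y x i j) (\<lambda>t. x t $ j) r t" for i j
    by (rule scalar_signal.dyadic_integral_add[OF signal _ st])
  then show ?thesis by (simp add: path_integral_def vec_eq_iff flip: sum.distrib)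
qed

lemma path_integral_local:
  assumes "0 \<le> s" "s \<le> t" "t \<le> T" "\<And>u. u \<in> {s..t} \<Longrightarrow> y u = z u"
  shows "path_integral F y x s t = path_integral F z x s t"
proof -
  have "dyadic_integral (integrand F y x i j) (\<lambda>t. x t $ j) s t = dyadic_integral (integrand F z x i j) (\<lambda>t. x t $ j) s t" for i j
    using assms T by (intro dyadic_integral_cong) (auto simp: integrand_def)
  then show ?thesis by (simp add: path_integral_def)
qed

lemma holder_volterra_path_integral: "holder_volterra (\<lambda>y s t. path_integral F y x s t) \<beta> \<epsilon> T K \<Lambda>"
proof
  show "0 < \<beta>" "0 < \<epsilon>" "0 \<le> T" "T \<le> 1" using exps \<epsilon>_pos T by auto
  show "0 \<le> K" "0 \<le> \<Lambda> Q M" for Q M using path_const_nonneg L C by (auto simp: K_def \<Lambda>_def)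
qed (fact path_integral_growth path_integral_lipschitz path_integral_additive path_integral_local)+

theorem exists_unique_solution:
  "\<exists>y. is_solution \<beta> T F x y0 y \<and> (\<forall>z. is_solution \<beta> T F x y0 z \<longrightarrow> (\<forall>t\<in>{0..T}. z t = y t))"
proof -
  interpret V: holder_volterra "\<lambda>y s t. path_integral F y x s t" \<beta> \<epsilon> T K \<Lambda>
    by (rule holder_volterra_path_integral)
  have "is_solution \<beta> T F x y0 y \<longleftrightarrow> V.solves y0 0 T y" for y
  proof
    assume y: "is_solution \<beta> T F x y0 y"
    then obtain M where "holder_on \<beta> 0 T M y" by (auto simp: is_solution_def holder_class_def holder_on_def)
    then have "holder_on \<beta> 0 T (max M 0) y" by (rule holder_on_mono) simp
    then show "V.solves y0 0 T y"
      using y unfolding V.solves_def is_solution_def by (metis max.cobounded2)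
  next
    assume y: "V.solves y0 0 T y"
    then obtain M where M: "0 \<le> M" "holder_on \<beta> 0 T M y" by (auto simp: V.solves_def)
    then have "path_integrable F y x 0 t" if "t \<in> {0..T}" for t
      using that by (intro path_integrable[of 0 t M] holder_on_subset[OF M(2)]) auto
    moreover have "y \<in> holder_class \<beta> T" using M by (auto simp: holder_class_def holder_on_def)
    ultimately show "is_solution \<beta> T F x y0 y"
      using y unfolding V.solves_def is_solution_def by blast
  qed
  then show ?thesis using V.exists_unique_solution[of y0] by simp
qed

end

section \<open>Existence and uniqueness for the driven equation\<close>

lemma scalar_signal_of_G_class:
  fixes x :: "real \<Rightarrow> real^'d"
  assumes exps: "0 < \<alpha>" and T: "0 \<le> T" "T \<le> 1" and G: "x \<in> G_class \<kappa> \<gamma> T"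
    and C: "0 \<le> C" "\<And>s t. s \<in> {0..T} \<Longrightarrow> t \<in> {0..T} \<Longrightarrow> norm (x s - x t) \<le> C * \<bar>s - t\<bar> powr \<alpha>"
    and R: "\<And>t. t \<in> {0..T} \<Longrightarrow> norm (x t) \<le> R"
  shows "scalar_signal (\<lambda>t. x t $ j) T \<alpha> C R (enn2real (G_norm \<kappa> \<gamma> T x)) \<kappa> \<gamma>"
proof
  show "\<bar>x s $ j - x t $ j\<bar> \<le> C * \<bar>s - t\<bar> powr \<alpha>" if "s \<in> {0..T}" "t \<in> {0..T}" for s t
    using C(2)[OF that] component_le_norm_cart[of "x s - x t" j] by simp
  show "continuous_on {0..T} (\<lambda>t. x t $ j)"
    using G by (auto simp: G_class_def intro!: continuous_intros)
  show "\<bar>x s $ j\<bar> \<le> R" if "s \<in> {0..T}" for s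
    using R[OF that] component_le_norm_cart[of "x s" j] by simp
  fix a b :: real assume ab: "0 \<le> a" "a < b" "b \<le> T"
  let ?p = "(b - a) powr (\<kappa> + \<gamma>)"
  have p: "?p > 0" using ab by simp
  have fin: "G_norm \<kappa> \<gamma> T x < top" using G by (simp add: G_class_def)
  have "mu (\<lambda>t. x t $ j) a b \<kappa> / ennreal ?p \<le> G_norm \<kappa> \<gamma> T x"
    unfolding G_norm_def by (rule SUP_upper2[of "(a, b, j)"]) (use ab in auto)
  then have "mu (\<lambda>t. x t $ j) a b \<kappa> / ennreal ?p * ennreal ?p \<le> G_norm \<kappa> \<gamma> T x * ennreal ?p"
    by (rule mult_right_mono) simp
  moreover have "mu (\<lambda>t. x t $ j) a b \<kappa> / ennreal ?p * ennreal ?p = mu (\<lambda>t. x t $ j) a b \<kappa>"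
    using p by (simp add: ennreal_divide_times divide_ennreal)
  moreover have "G_norm \<kappa> \<gamma> T x * ennreal ?p = ennreal (enn2real (G_norm \<kappa> \<gamma> T x) * ?p)"
    using fin by (simp add: ennreal_mult ennreal_enn2real)
  ultimately show "mu (\<lambda>t. x t $ j) a b \<kappa> \<le> ennreal (enn2real (G_norm \<kappa> \<gamma> T x) * ?p)" by simp
qed (use exps T C in auto)

theorem theorem3p2:
  fixes \<alpha> \<beta> \<gamma> \<theta> \<beta>\<^sub>0 T :: real
    and F :: "real \<Rightarrow> real^'m \<Rightarrow> real^'d \<Rightarrow> real^'d^'m"
    and x :: "real \<Rightarrow> real^'d"
    and y0 :: "real^'m"
  assumes "0 < \<beta>" "\<beta> \<le> \<alpha>" "\<alpha> \<le> 1"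
    and "0 < \<theta>" "\<theta> \<le> 1"
    and "0 \<le> T" "T \<le> 1"
    and "\<And>i j. continuous_coeff (\<lambda>t y x. F t y x $ i $ j)"
    and "\<And>i j. holder_except \<theta> j (\<lambda>t y x. F t y x $ i $ j)"
    and "\<And>i j. \<exists>D. has_y_gradient (\<lambda>t y x. F t y x $ i $ j) D \<and>
                  continuous_coeff D \<and> holder_except \<theta> j D"
    and "\<gamma> > 0" "0 < \<beta> - \<gamma>" "\<beta> - \<gamma> < \<beta>\<^sub>0" "\<beta>\<^sub>0 < \<theta> * \<beta>"
    and "x \<in> G_class \<beta>\<^sub>0 \<gamma> T \<inter> holder_class \<alpha> T"
  shows "\<exists>y. is_solution \<beta> T F x y0 y \<and>
             (\<forall>z. is_solution \<beta> T F x y0 z \<longrightarrow> (\<forall>t\<in>{0..T}. z t = y t))"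
proof -
  have G: "x \<in> G_class \<beta>\<^sub>0 \<gamma> T" and H: "x \<in> holder_class \<alpha> T" using assms(15) by auto
  obtain C0 where C0: "\<And>s t. s \<in> {0..T} \<Longrightarrow> t \<in> {0..T} \<Longrightarrow> norm (x s - x t) \<le> C0 * \<bar>s - t\<bar> powr \<alpha>"
    using H unfolding holder_class_def by blast
  define C where "C = \<bar>C0\<bar>"
  have C: "norm (x s - x t) \<le> C * \<bar>s - t\<bar> powr \<alpha>" if "s \<in> {0..T}" "t \<in> {0..T}" for s t
    by (rule order_trans[OF C0[OF that]], rule mult_right_mono) (auto simp: C_def)
  have "bounded (x ` {0..T})"
    using G by (intro compact_imp_bounded compact_continuous_image) (auto simp: G_class_def)
  then obtain R where R: "\<And>t. t \<in> {0..T} \<Longrightarrow> norm (x t) \<le> R" by (fastforce simp: bounded_iff)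
  obtain D where D: "\<And>i j. has_y_gradient (\<lambda>t y x. F t y x $ i $ j) (D i j)"
    "\<And>i j. continuous_coeff (D i j)" "\<And>i j. holder_except \<theta> j (D i j)"
    using assms(10) by metis
  define L1 where "L1 i j = (SOME l. controlled \<theta> j R l (\<lambda>t y x. F t y x $ i $ j))" for i j
  define L2 where "L2 i j = (SOME l. controlled \<theta> j R l (D i j))" for i j
  have L1: "controlled \<theta> j R (L1 i j) (\<lambda>t y x. F t y x $ i $ j)" for i j
    unfolding L1_def by (rule someI_ex[OF holder_except_controlled[OF assms(9,8,4,5)]])
  have L2: "controlled \<theta> j R (L2 i j) (D i j)" for i j
    unfolding L2_def by (rule someI_ex[OF holder_except_controlled[OF D(3,2) assms(4,5)]])
  define L where "L = (\<Sum>i\<in>UNIV. \<Sum>j\<in>UNIV. \<bar>L1 i j\<bar> + \<bar>L2 i j\<bar>)"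
  have L: "0 \<le> L" unfolding L_def by (intro sum_nonneg) auto
  have le: "L1 i j \<le> L" "L2 i j \<le> L" for i j
  proof -
    have "\<bar>L1 i j\<bar> + \<bar>L2 i j\<bar> \<le> (\<Sum>j\<in>UNIV. \<bar>L1 i j\<bar> + \<bar>L2 i j\<bar>)"
      by (rule member_le_sum) auto
    also have "\<dots> \<le> L" unfolding L_def
      by (rule member_le_sum[where f = "\<lambda>i. \<Sum>j\<in>UNIV. \<bar>L1 i j\<bar> + \<bar>L2 i j\<bar>"]) (auto intro: sum_nonneg)
    finally show "L1 i j \<le> L" "L2 i j \<le> L" by linarith+
  qed
  interpret driven_equation \<alpha> \<beta> \<gamma> \<theta> \<beta>\<^sub>0 T C R "enn2real (G_norm \<beta>\<^sub>0 \<gamma> T x)" L F D x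
  proof (rule driven_equation.intro)
    show "scalar_signal (\<lambda>t. x t $ j) T \<alpha> C R (enn2real (G_norm \<beta>\<^sub>0 \<gamma> T x)) \<beta>\<^sub>0 \<gamma>" for j
      using assms G C R by (intro scalar_signal_of_G_class) (auto simp: C_def)
    show "continuous_coeff (\<lambda>t y x. F t y x $ i $ j)" for i j by (rule assms(8))
    show "((\<lambda>p. F t p x $ i $ j) has_derivative (\<lambda>h. D i j t p x \<bullet> h)) (at p)" if "0 \<le> t" for i j t p x
      using has_y_gradient_has_derivative[OF D(1,2) that] .
    show "controlled \<theta> j R L (\<lambda>t y x. F t y x $ i $ j)" for i j
      by (rule controlled_mono[OF L1 le(1)])
    show "controlled \<theta> j R L (D i j)" for i j
      by (rule controlled_mono[OF L2 le(2)])
  qed (use assms C L in auto)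
  show ?thesis by (rule exists_unique_solution)
qed

end
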